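(* Let $M$ be a hypersurface in a Riemannian space of constant curvature $N^{n+1}(c)$, $n \geq 4$, such that at every point $M$ has exactly two distinct principal curvatures, $\lambda_{1}$ with multiplicity $p$ and $\lambda_{2}$ with multiplicity $n-p$, where $2 \leq p \leq n-2$. If $$(p-1)\lambda_{1} + (n-p-1)\lambda_{2} \neq 0$$ at every point of $M$, then $M = \mathcal{U}_{S}\cap\mathcal{U}_{C}$ and there exist functions $\phi,\mu,\eta$ on $M$ such that $$R = \frac{\phi}{2}\, S\wedge S + \mu\, g\wedge S + \frac{\eta}{2}\, g\wedge g$$ on $M$, i.e., $M$ is a Roter space. In particular, $M$ is a non-quasi-Einstein partially Einstein space.
   Context: All manifolds are connected, paracompact and of class $C^\infty$. $N^{n+1}(c)$ is an $(n+1)$-dimensional Riemannian space of constant curvature $c$; the hypersurface $M$ is isometrically immersed, with induced metric $g$. $R$, $S$, $\kappa$, $C$ are the Riemann-Christoffel curvature tensor, Ricci tensor, scalar curvature and Weyl conformal curvature tensor of $(M,g)$, with conventions $\mathcal{R}(X,Y)Z=\nabla_X\nabla_YZ-\nabla_Y\nabla_XZ-\nabla_{[X,Y]}Z$, $R(X_1,X_2,X_3,X_4)=g(\mathcal{R}(X_1,X_2)X_3,X_4)$, $S(X,Y)=\mathrm{tr}\{Z\mapsto\mathcal{R}(Z,X)Y\}$, $C=R-\frac{1}{n-2}g\wedge S+\frac{\kappa}{2(n-2)(n-1)}g\wedge g$. The Kulkarni-Nomizu product of symmetric $(0,2)$-tensors $E,F$ is $(E\wedge F)(X_1,X_2,X_3,X_4)=E(X_1,X_4)F(X_2,X_3)+E(X_2,X_3)F(X_1,X_4)-E(X_1,X_3)F(X_2,X_4)-E(X_2,X_4)F(X_1,X_3)$.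 $\mathcal{U}_S$ is the set of points where $S\neq\frac{\kappa}{n}g$; $\mathcal{U}_C$ is the set of points where $C\neq0$. $S^2$ is defined by $S^2(X,Y)=S(\mathcal{S}X,Y)$, with $g(\mathcal{S}X,Y)=S(X,Y)$. $(M,g)$ is quasi-Einstein if $\mathrm{rank}(S-\alpha g)=1$ on $\mathcal{U}_S$ for some function $\alpha$ on $\mathcal{U}_S$; it is partially Einstein if $S^2=\lambda S+\mu' g$ on $\mathcal{U}_S$ for some functions $\lambda,\mu'$ on $\mathcal{U}_S$. A Roter space is a non-conformally flat semi-Riemannian manifold of dimension $n\geq4$ whose tensor $R$ is at every point of $\mathcal{U}_S\cap\mathcal{U}_C$ a linear combination of $g\wedge g$, $g\wedge S$ and $S\wedge S$. *)

theory Defs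
  imports "HOL-Analysis.Analysis"
begin

section \<open>Smooth manifolds\<close>

text \<open>Only used for open sets \<open>S\<close>.\<close>

primrec Ck_on :: "nat \<Rightarrow> 'v::real_normed_vector set \<Rightarrow> ('v \<Rightarrow> 'w::real_normed_vector) \<Rightarrow> bool" where
  "Ck_on 0 S f \<longleftrightarrow> continuous_on S f"
| "Ck_on (Suc k) S f \<longleftrightarrow>
     (\<forall>x\<in>S. f differentiable (at x)) \<and> (\<forall>v. Ck_on k S (\<lambda>x. frechet_derivative f (at x) v))"

definition smooth_on :: "'v::real_normed_vector set \<Rightarrow> ('v \<Rightarrow> 'w::real_normed_vector) \<Rightarrow> bool" where
  "smooth_on S f \<longleftrightarrow> (\<forall>k. Ck_on k S f)"

definition paracompact_space :: "'a topology \<Rightarrow> bool" where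
  "paracompact_space X \<longleftrightarrow>
     (\<forall>\<U>. (\<forall>U\<in>\<U>. openin X U) \<and> \<Union>\<U> = topspace X \<longrightarrow>
       (\<exists>\<V>. (\<forall>V\<in>\<V>. openin X V \<and> (\<exists>U\<in>\<U>. V \<subseteq> U)) \<and> \<Union>\<V> = topspace X \<and> locally_finite_in X \<V>))"

text \<open>A chart is a pair of its domain and its coordinate map; the values of the coordinate map
  outside the domain are irrelevant.\<close>

type_synonym ('a, 'n) chart = "'a set \<times> ('a \<Rightarrow> real ^ 'n)"

abbreviation dom_of :: "('a, 'n) chart \<Rightarrow> 'a set" where
  "dom_of c \<equiv> fst c"

abbreviation coord :: "('a, 'n) chart \<Rightarrow> 'a \<Rightarrow> real ^ 'n" where
  "coord c \<equiv> snd c"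

abbreviation codom_of :: "('a, 'n) chart \<Rightarrow> (real ^ 'n) set" where
  "codom_of c \<equiv> coord c ` dom_of c"

definition param :: "('a, 'n) chart \<Rightarrow> real ^ 'n \<Rightarrow> 'a" where
  "param c = inv_into (dom_of c) (coord c)"

definition is_chart :: "'a topology \<Rightarrow> ('a, 'n::finite) chart \<Rightarrow> bool" where
  "is_chart M c \<longleftrightarrow>
     openin M (dom_of c) \<and> open (codom_of c) \<and>
     homeomorphic_map (subtopology M (dom_of c)) (top_of_set (codom_of c)) (coord c)"

definition transition :: "('a, 'n) chart \<Rightarrow> ('a, 'n) chart \<Rightarrow> real ^ 'n \<Rightarrow> real ^ 'n" where
  "transition c c' = coord c' \<circ> param c"

definition smooth_manifold :: "'a topology \<Rightarrow> ('a, 'n::finite) chart set \<Rightarrow> bool" where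
  "smooth_manifold M \<A> \<longleftrightarrow>
     topspace M \<noteq> {} \<and> connected_space M \<and> Hausdorff_space M \<and> paracompact_space M \<and>
     (\<forall>c\<in>\<A>. is_chart M c) \<and> (\<Union>c\<in>\<A>. dom_of c) = topspace M \<and>
     (\<forall>c\<in>\<A>. \<forall>c'\<in>\<A>. smooth_on (coord c ` (dom_of c \<inter> dom_of c')) (transition c c'))"

section \<open>Metrics\<close>

text \<open>The tangent spaces at the points of the domain of a chart are identified with \<open>real ^ 'n\<close>
  by the coordinate basis of that chart. A metric on a manifold is given by its expression
  \<open>g c u v w\<close> in every chart \<open>c\<close> of the atlas, at the coordinate point \<open>u\<close> and on the vectors
  with components \<open>v\<close> and \<open>w\<close>; these expressions are related by the tensor transformation law.\<close>

type_synonym 'v form2 = "'v \<Rightarrow> 'v \<Rightarrow> real"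
type_synonym 'v form4 = "'v \<Rightarrow> 'v \<Rightarrow> 'v \<Rightarrow> 'v \<Rightarrow> real"
type_synonym ('a, 'n) metric_tensor = "('a, 'n) chart \<Rightarrow> real ^ 'n \<Rightarrow> (real ^ 'n) form2"

definition semi_riemannian_manifold ::
  "'a topology \<Rightarrow> ('a, 'n::finite) chart set \<Rightarrow> ('a, 'n) metric_tensor \<Rightarrow> bool" where
  "semi_riemannian_manifold M \<A> g \<longleftrightarrow>
     smooth_manifold M \<A> \<and>
     (\<forall>c\<in>\<A>. \<forall>u\<in>codom_of c. bilinear (g c u) \<and> (\<forall>v w. g c u v w = g c u w v) \<and>
        (\<forall>v. (\<forall>w. g c u v w = 0) \<longrightarrow> v = 0)) \<and>
     (\<forall>c\<in>\<A>. \<forall>v w. smooth_on (codom_of c) (\<lambda>u. g c u v w)) \<and>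
     (\<forall>c\<in>\<A>. \<forall>c'\<in>\<A>. \<forall>x\<in>dom_of c \<inter> dom_of c'. \<forall>v w.
        g c (coord c x) v w =
        g c' (coord c' x) (frechet_derivative (transition c c') (at (coord c x)) v)
                          (frechet_derivative (transition c c') (at (coord c x)) w))"

definition riemannian_manifold ::
  "'a topology \<Rightarrow> ('a, 'n::finite) chart set \<Rightarrow> ('a, 'n) metric_tensor \<Rightarrow> bool" where
  "riemannian_manifold M \<A> g \<longleftrightarrow>
     semi_riemannian_manifold M \<A> g \<and>
     (\<forall>c\<in>\<A>. \<forall>u\<in>codom_of c. \<forall>v. v \<noteq> 0 \<longrightarrow> 0 < g c u v v)"

section \<open>Curvature in a coordinate domain\<close>

text \<open>In this section \<open>\<gamma>\<close> is a metric on an open subset of \<open>real ^ 'n\<close>, and vector fields are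
  functions \<open>real ^ 'n \<Rightarrow> real ^ 'n\<close>.

  The Levi-Civita connection is given by its Christoffel map \<open>\<Gamma>\<close> at \<open>u\<close>, that is, by
  \<open>\<Gamma> x y = \<nabla>\<^bsub>x\<^esub> Y\<close> for the constant extension \<open>Y\<close> of \<open>y\<close>. The conditions say that the connection is
  torsion-free and metric.\<close>

definition christoffel ::
  "(real ^ 'n \<Rightarrow> (real ^ 'n) form2) \<Rightarrow> real ^ 'n \<Rightarrow> real ^ 'n \<Rightarrow> real ^ 'n \<Rightarrow> real ^ ('n::finite)" where
  "christoffel \<gamma> u =
     (THE \<Gamma>. bilinear \<Gamma> \<and> (\<forall>x y. \<Gamma> x y = \<Gamma> y x) \<and>
        (\<forall>x y z. frechet_derivative (\<lambda>u. \<gamma> u y z) (at u) x = \<gamma> u (\<Gamma> x y) z + \<gamma> u y (\<Gamma> x z)))"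

definition cov_deriv ::
  "(real ^ 'n \<Rightarrow> (real ^ 'n) form2) \<Rightarrow>
   (real ^ 'n \<Rightarrow> real ^ 'n) \<Rightarrow> (real ^ 'n \<Rightarrow> real ^ 'n) \<Rightarrow> real ^ 'n \<Rightarrow> real ^ ('n::finite)" where
  "cov_deriv \<gamma> X Y u = frechet_derivative Y (at u) (X u) + christoffel \<gamma> u (X u) (Y u)"

definition lie_bracket ::
  "(real ^ 'n \<Rightarrow> real ^ 'n) \<Rightarrow> (real ^ 'n \<Rightarrow> real ^ 'n) \<Rightarrow> real ^ 'n \<Rightarrow> real ^ ('n::finite)" where
  "lie_bracket X Y u = frechet_derivative Y (at u) (X u) - frechet_derivative X (at u) (Y u)"

definition curvature_field ::
  "(real ^ 'n \<Rightarrow> (real ^ 'n) form2) \<Rightarrow>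
   (real ^ 'n \<Rightarrow> real ^ 'n) \<Rightarrow> (real ^ 'n \<Rightarrow> real ^ 'n) \<Rightarrow> (real ^ 'n \<Rightarrow> real ^ 'n) \<Rightarrow>
   real ^ 'n \<Rightarrow> real ^ ('n::finite)" where
  "curvature_field \<gamma> X Y Z u =
     cov_deriv \<gamma> X (cov_deriv \<gamma> Y Z) u - cov_deriv \<gamma> Y (cov_deriv \<gamma> X Z) u
       - cov_deriv \<gamma> (lie_bracket X Y) Z u"

text \<open>The value of the curvature operator on vectors is computed with their constant extensions
  to the coordinate domain.\<close>

definition curvature_op ::
  "(real ^ 'n \<Rightarrow> (real ^ 'n) form2) \<Rightarrow> real ^ 'n \<Rightarrow>
   real ^ 'n \<Rightarrow> real ^ 'n \<Rightarrow> real ^ 'n \<Rightarrow> real ^ ('n::finite)" where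
  "curvature_op \<gamma> u x y z = curvature_field \<gamma> (\<lambda>_. x) (\<lambda>_. y) (\<lambda>_. z) u"

definition curvature_form ::
  "(real ^ 'n \<Rightarrow> (real ^ 'n) form2) \<Rightarrow> real ^ 'n \<Rightarrow> (real ^ ('n::finite)) form4" where
  "curvature_form \<gamma> u x1 x2 x3 x4 = \<gamma> u (curvature_op \<gamma> u x1 x2 x3) x4"

section \<open>Algebra of symmetric forms\<close>

definition KN :: "'v form2 \<Rightarrow> 'v form2 \<Rightarrow> 'v form4" where
  "KN E F x1 x2 x3 x4 = E x1 x4 * F x2 x3 + E x2 x3 * F x1 x4 - E x1 x3 * F x2 x4 - E x2 x4 * F x1 x3"

text \<open>The endomorphism \<open>L\<close> with \<open>b (L x) y = B x y\<close>, for a nondegenerate form \<open>b\<close>.\<close>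

definition form_operator :: "'v form2 \<Rightarrow> 'v form2 \<Rightarrow> 'v \<Rightarrow> 'v" where
  "form_operator b B = (THE L. \<forall>x y. b (L x) y = B x y)"

definition form_rank :: "(real ^ 'n) form2 \<Rightarrow> nat" where
  "form_rank B = rank ((\<chi> i j. B (axis i 1) (axis j 1)) :: real ^ 'n ^ ('n::finite))"

section \<open>Tensors on a manifold\<close>

text \<open>The tangent space at a point \<open>x\<close> is identified with \<open>real ^ 'n\<close> by means of a chart chosen
  around \<open>x\<close>. All tensors at \<open>x\<close> are given by their components in that chart.\<close>

definition chart_at :: "('a, 'n) chart set \<Rightarrow> 'a \<Rightarrow> ('a, 'n) chart" where
  "chart_at \<A> x = (SOME c. c \<in> \<A> \<and> x \<in> dom_of c)"

definition coord_at :: "('a, 'n) chart set \<Rightarrow> 'a \<Rightarrow> real ^ 'n" where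
  "coord_at \<A> x = coord (chart_at \<A> x) x"

definition metric_at :: "('a, 'n) chart set \<Rightarrow> ('a, 'n) metric_tensor \<Rightarrow> 'a \<Rightarrow> (real ^ 'n) form2" where
  "metric_at \<A> g x = g (chart_at \<A> x) (coord_at \<A> x)"

definition riemann ::
  "('a, 'n::finite) chart set \<Rightarrow> ('a, 'n) metric_tensor \<Rightarrow> 'a \<Rightarrow> (real ^ 'n) form4" where
  "riemann \<A> g x = curvature_form (g (chart_at \<A> x)) (coord_at \<A> x)"

definition ricci ::
  "('a, 'n::finite) chart set \<Rightarrow> ('a, 'n) metric_tensor \<Rightarrow> 'a \<Rightarrow> (real ^ 'n) form2" where
  "ricci \<A> g x v w =
     trace (matrix (\<lambda>z. curvature_op (g (chart_at \<A> x)) (coord_at \<A> x) z v w))"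

definition ricci_operator ::
  "('a, 'n::finite) chart set \<Rightarrow> ('a, 'n) metric_tensor \<Rightarrow> 'a \<Rightarrow> real ^ 'n \<Rightarrow> real ^ 'n" where
  "ricci_operator \<A> g x = form_operator (metric_at \<A> g x) (ricci \<A> g x)"

definition ricci_sq ::
  "('a, 'n::finite) chart set \<Rightarrow> ('a, 'n) metric_tensor \<Rightarrow> 'a \<Rightarrow> (real ^ 'n) form2" where
  "ricci_sq \<A> g x v w = ricci \<A> g x (ricci_operator \<A> g x v) w"

definition scalar_curvature ::
  "('a, 'n::finite) chart set \<Rightarrow> ('a, 'n) metric_tensor \<Rightarrow> 'a \<Rightarrow> real" where
  "scalar_curvature \<A> g x = trace (matrix (ricci_operator \<A> g x))"

definition weyl ::
  "('a, 'n::finite) chart set \<Rightarrow> ('a, 'n) metric_tensor \<Rightarrow> 'a \<Rightarrow> (real ^ 'n) form4" where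
  "weyl \<A> g x x1 x2 x3 x4 =
     riemann \<A> g x x1 x2 x3 x4
     - 1 / (real CARD('n) - 2) * KN (metric_at \<A> g x) (ricci \<A> g x) x1 x2 x3 x4
     + scalar_curvature \<A> g x / (2 * (real CARD('n) - 2) * (real CARD('n) - 1))
         * KN (metric_at \<A> g x) (metric_at \<A> g x) x1 x2 x3 x4"

definition U_S ::
  "'a topology \<Rightarrow> ('a, 'n::finite) chart set \<Rightarrow> ('a, 'n) metric_tensor \<Rightarrow> 'a set" where
  "U_S M \<A> g = {x \<in> topspace M.
     ricci \<A> g x \<noteq> (\<lambda>v w. scalar_curvature \<A> g x / real CARD('n) * metric_at \<A> g x v w)}"

definition U_C ::
  "'a topology \<Rightarrow> ('a, 'n::finite) chart set \<Rightarrow> ('a, 'n) metric_tensor \<Rightarrow> 'a set" where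
  "U_C M \<A> g = {x \<in> topspace M. weyl \<A> g x \<noteq> (\<lambda>x1 x2 x3 x4. 0)}"

definition constant_curvature ::
  "'a topology \<Rightarrow> ('a, 'n::finite) chart set \<Rightarrow> ('a, 'n) metric_tensor \<Rightarrow> real \<Rightarrow> bool" where
  "constant_curvature M \<A> g k \<longleftrightarrow>
     (\<forall>x\<in>topspace M. \<forall>v w.
        metric_at \<A> g x v v * metric_at \<A> g x w w - (metric_at \<A> g x v w)\<^sup>2 \<noteq> 0 \<longrightarrow>
        riemann \<A> g x v w w v /
          (metric_at \<A> g x v v * metric_at \<A> g x w w - (metric_at \<A> g x v w)\<^sup>2) = k)"

text \<open>Around every point the metric becomes flat after a conformal change \<open>exp (2 * \<sigma>)\<close>.\<close>

definition conformally_flat ::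
  "'a topology \<Rightarrow> ('a, 'n::finite) chart set \<Rightarrow> ('a, 'n) metric_tensor \<Rightarrow> bool" where
  "conformally_flat M \<A> g \<longleftrightarrow>
     (\<forall>x\<in>topspace M. \<exists>V \<sigma>. open V \<and> coord_at \<A> x \<in> V \<and> V \<subseteq> codom_of (chart_at \<A> x) \<and>
        smooth_on V \<sigma> \<and>
        (\<forall>u\<in>V. \<forall>x1 x2 x3 x4.
           curvature_form (\<lambda>u v w. exp (2 * \<sigma> u) * g (chart_at \<A> x) u v w) u x1 x2 x3 x4 = 0))"

definition quasi_einstein ::
  "'a topology \<Rightarrow> ('a, 'n::finite) chart set \<Rightarrow> ('a, 'n) metric_tensor \<Rightarrow> bool" where
  "quasi_einstein M \<A> g \<longleftrightarrow>
     (\<exists>\<alpha>. \<forall>x\<in>U_S M \<A> g. form_rank (\<lambda>v w. ricci \<A> g x v w - \<alpha> x * metric_at \<A> g x v w) = 1)"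

definition partially_einstein ::
  "'a topology \<Rightarrow> ('a, 'n::finite) chart set \<Rightarrow> ('a, 'n) metric_tensor \<Rightarrow> bool" where
  "partially_einstein M \<A> g \<longleftrightarrow>
     (\<exists>l m. \<forall>x\<in>U_S M \<A> g. \<forall>v w.
        ricci_sq \<A> g x v w = l x * ricci \<A> g x v w + m x * metric_at \<A> g x v w)"

definition roter_space ::
  "'a topology \<Rightarrow> ('a, 'n::finite) chart set \<Rightarrow> ('a, 'n) metric_tensor \<Rightarrow> bool" where
  "roter_space M \<A> g \<longleftrightarrow>
     semi_riemannian_manifold M \<A> g \<and> 4 \<le> CARD('n) \<and> \<not> conformally_flat M \<A> g \<and>
     (\<forall>x\<in>U_S M \<A> g \<inter> U_C M \<A> g. \<exists>a b d. \<forall>x1 x2 x3 x4.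
        riemann \<A> g x x1 x2 x3 x4 =
          a * KN (metric_at \<A> g x) (metric_at \<A> g x) x1 x2 x3 x4
          + b * KN (metric_at \<A> g x) (ricci \<A> g x) x1 x2 x3 x4
          + d * KN (ricci \<A> g x) (ricci \<A> g x) x1 x2 x3 x4)"

section \<open>Isometric immersions and hypersurfaces\<close>

definition local_rep ::
  "('a, 'n) chart \<Rightarrow> ('b, 'm) chart \<Rightarrow> ('a \<Rightarrow> 'b) \<Rightarrow> real ^ 'n \<Rightarrow> real ^ 'm" where
  "local_rep c d f = coord d \<circ> f \<circ> param c"

text \<open>Immersivity is not listed separately: it follows from the last condition because the metric
  of the source is nondegenerate.\<close>

definition isometric_immersion ::
  "'a topology \<Rightarrow> ('a, 'n::finite) chart set \<Rightarrow> ('a, 'n) metric_tensor \<Rightarrow>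
   'b topology \<Rightarrow> ('b, 'm::finite) chart set \<Rightarrow> ('b, 'm) metric_tensor \<Rightarrow> ('a \<Rightarrow> 'b) \<Rightarrow> bool" where
  "isometric_immersion M \<A> g N \<B> G f \<longleftrightarrow>
     continuous_map M N f \<and>
     (\<forall>c\<in>\<A>. \<forall>d\<in>\<B>.
        smooth_on (coord c ` (dom_of c \<inter> f -` dom_of d)) (local_rep c d f) \<and>
        (\<forall>x\<in>dom_of c \<inter> f -` dom_of d. \<forall>v w.
           g c (coord c x) v w =
           G d (coord d (f x)) (frechet_derivative (local_rep c d f) (at (coord c x)) v)
                               (frechet_derivative (local_rep c d f) (at (coord c x)) w)))"

definition pushforward ::
  "('a, 'n::finite) chart set \<Rightarrow> ('b, 'm::finite) chart set \<Rightarrow> ('a \<Rightarrow> 'b) \<Rightarrow> 'a \<Rightarrow>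
   real ^ 'n \<Rightarrow> real ^ 'm" where
  "pushforward \<A> \<B> f x =
     frechet_derivative (local_rep (chart_at \<A> x) (chart_at \<B> (f x)) f) (at (coord_at \<A> x))"

definition unit_normal ::
  "('a, 'n::finite) chart set \<Rightarrow> ('b, 'm::finite) chart set \<Rightarrow> ('b, 'm) metric_tensor \<Rightarrow>
   ('a \<Rightarrow> 'b) \<Rightarrow> 'a \<Rightarrow> real ^ 'm \<Rightarrow> bool" where
  "unit_normal \<A> \<B> G f x \<nu> \<longleftrightarrow>
     metric_at \<B> G (f x) \<nu> \<nu> = 1 \<and>
     (\<forall>v. metric_at \<B> G (f x) (pushforward \<A> \<B> f x v) \<nu> = 0)"

text \<open>The covariant derivative in the direction \<open>v\<close>, at \<open>u\<close>, of a vector field \<open>Y\<close> along a map \<open>F\<close>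
  into a coordinate domain with metric \<open>\<gamma>\<close>.\<close>

definition cov_deriv_along ::
  "(real ^ 'm \<Rightarrow> (real ^ 'm) form2) \<Rightarrow> (real ^ 'n \<Rightarrow> real ^ 'm) \<Rightarrow>
   real ^ ('n::finite) \<Rightarrow> (real ^ 'n \<Rightarrow> real ^ 'm) \<Rightarrow> real ^ 'n \<Rightarrow> real ^ ('m::finite)" where
  "cov_deriv_along \<gamma> F v Y u =
     frechet_derivative Y (at u) v + christoffel \<gamma> (F u) (frechet_derivative F (at u) v) (Y u)"

text \<open>By the Gauss formula, \<open>h v w\<close> is the \<open>\<nu>\<close>-component of the ambient covariant derivative in the
  direction \<open>v\<close> of the push-forward of (the constant extension of) \<open>w\<close>.\<close>

definition second_fundamental_form ::
  "('a, 'n::finite) chart set \<Rightarrow> ('b, 'm::finite) chart set \<Rightarrow> ('b, 'm) metric_tensor \<Rightarrow>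
   ('a \<Rightarrow> 'b) \<Rightarrow> 'a \<Rightarrow> real ^ 'm \<Rightarrow> (real ^ 'n) form2" where
  "second_fundamental_form \<A> \<B> G f x \<nu> v w =
     (let F = local_rep (chart_at \<A> x) (chart_at \<B> (f x)) f in
      metric_at \<B> G (f x)
        (cov_deriv_along (G (chart_at \<B> (f x))) F v (\<lambda>u. frechet_derivative F (at u) w) (coord_at \<A> x))
        \<nu>)"

definition shape_operator ::
  "('a, 'n::finite) chart set \<Rightarrow> ('a, 'n) metric_tensor \<Rightarrow>
   ('b, 'm::finite) chart set \<Rightarrow> ('b, 'm) metric_tensor \<Rightarrow>
   ('a \<Rightarrow> 'b) \<Rightarrow> 'a \<Rightarrow> real ^ 'm \<Rightarrow> real ^ 'n \<Rightarrow> real ^ 'n" where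
  "shape_operator \<A> g \<B> G f x \<nu> =
     form_operator (metric_at \<A> g x) (second_fundamental_form \<A> \<B> G f x \<nu>)"

definition eigenspace_of :: "('v::real_vector \<Rightarrow> 'v) \<Rightarrow> real \<Rightarrow> 'v set" where
  "eigenspace_of L l = {v. L v = l *\<^sub>R v}"

definition principal_curvatures ::
  "('a, 'n::finite) chart set \<Rightarrow> ('a, 'n) metric_tensor \<Rightarrow>
   ('b, 'm::finite) chart set \<Rightarrow> ('b, 'm) metric_tensor \<Rightarrow>
   ('a \<Rightarrow> 'b) \<Rightarrow> 'a \<Rightarrow> real ^ 'm \<Rightarrow> real set" where
  "principal_curvatures \<A> g \<B> G f x \<nu> =
     {l. \<exists>v. v \<noteq> 0 \<and> v \<in> eigenspace_of (shape_operator \<A> g \<B> G f x \<nu>) l}"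

text \<open>The shape operator is self-adjoint with respect to a positive definite metric, so that the
  geometric and the algebraic multiplicities agree.\<close>

definition multiplicity_of ::
  "('a, 'n::finite) chart set \<Rightarrow> ('a, 'n) metric_tensor \<Rightarrow>
   ('b, 'm::finite) chart set \<Rightarrow> ('b, 'm) metric_tensor \<Rightarrow>
   ('a \<Rightarrow> 'b) \<Rightarrow> 'a \<Rightarrow> real ^ 'm \<Rightarrow> real \<Rightarrow> nat" where
  "multiplicity_of \<A> g \<B> G f x \<nu> l = dim (eigenspace_of (shape_operator \<A> g \<B> G f x \<nu>) l)"

end

theory Submission
  imports Defs
begin

text \<open>
  Let \<open>h\<close> be the second fundamental form and \<open>A\<close> the shape operator of the hypersurface. In a space of
  constant curvature \<open>c\<close> the Gauss equation is \<open>R = c/2 g \<and> g + 1/2 h \<and> h\<close> (\<open>hypersurface_curvature\<close>),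
  and from there on the argument is linear algebra in one tangent space, collected in the locale
  \<open>two_principal_curvatures\<close>. The eigenspaces of \<open>A\<close> are orthogonal and span the tangent
  space. On the eigenspace of \<open>\<lambda>\<^sub>i\<close> one has \<open>h = \<lambda>\<^sub>i g\<close>, and contracting \<open>R\<close> gives \<open>S = \<rho>\<^sub>i g\<close> with
  \<open>\<rho>\<^sub>i = (n - 1) c + tr(A) \<lambda>\<^sub>i - \<lambda>\<^sub>i\<^sup>2\<close>. Since \<open>tr(A) = p \<lambda>\<^sub>1 + (n - p) \<lambda>\<^sub>2\<close>,
  \<open>\<rho>\<^sub>1 - \<rho>\<^sub>2 = (\<lambda>\<^sub>1 - \<lambda>\<^sub>2) ((p - 1) \<lambda>\<^sub>1 + (n - p - 1) \<lambda>\<^sub>2)\<close>,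
  so the assumption on the principal curvatures says exactly that \<open>S\<close> separates the two eigenspaces.

  Hence \<open>S\<close> is not a multiple of \<open>g\<close>, the Ricci operator is annihilated by a quadratic polynomial
  (partially Einstein), and \<open>S - \<alpha> g\<close> is definite on at least one of the two
  eigenspaces, so that its rank is at least two (not quasi-Einstein). Interpolating the two eigenvalues
  yields \<open>h = a S + d g\<close>, and inserting this into \<open>1/2 h \<and> h\<close> gives the Roter equation.

  If the Weyl tensor vanished at a point, or if \<open>M\<close> were conformally flat, then \<open>R = g \<and> F\<close> for some
  \<open>F\<close>; in the second case \<open>F\<close> comes from the transformation law of the curvature under a
  conformal change (\<open>curvature_form_conformal\<close>). Then the sectional curvature \<open>K\<close> of orthonormal
  vectors is additive, \<open>K(e,f) = F(e,e) + F(f,f)\<close>, so for \<open>e\<^sub>1\<close>, \<open>e\<^sub>2\<close> in one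
  eigenspace and \<open>f\<^sub>1\<close>, \<open>f\<^sub>2\<close> in the other
  \<open>K(e\<^sub>1,e\<^sub>2) + K(f\<^sub>1,f\<^sub>2) = K(e\<^sub>1,f\<^sub>1) + K(e\<^sub>2,f\<^sub>2)\<close>, that is,
  \<open>\<lambda>\<^sub>1\<^sup>2 + \<lambda>\<^sub>2\<^sup>2 = 2 \<lambda>\<^sub>1 \<lambda>\<^sub>2\<close>, which contradicts \<open>\<lambda>\<^sub>1 \<noteq> \<lambda>\<^sub>2\<close> (\<open>curv_not_KN\<close>).

  The differential geometry rests on one formula (\<open>curvature_form_eq\<close>): up to terms that are
  quadratic in the Christoffel map, \<open>g(R(x,y)z, w)\<close> is the antisymmetrized derivative of the Koszul
  expression for \<open>g(\<nabla>\<^bsub>y\<^esub> z, w)\<close>. It yields the symmetries of the curvature, which turn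
  constant sectional curvature into a formula for the whole tensor, the Gauss equation, and the conformal
  transformation law.
\<close>

section \<open>Smooth functions and their second derivatives\<close>

abbreviation dir_deriv ::
  "('v::real_normed_vector \<Rightarrow> 'w::real_normed_vector) \<Rightarrow> 'v \<Rightarrow> 'v \<Rightarrow> 'w" where
  "dir_deriv f u v \<equiv> frechet_derivative f (at u) v"

lemma dir_deriv_eqI: "(f has_derivative f') (at u) \<Longrightarrow> dir_deriv f u v = f' v"
  by (simp add: frechet_derivative_at[symmetric])

lemma dir_deriv_has_derivative:
  "f differentiable (at u) \<Longrightarrow> (f has_derivative dir_deriv f u) (at u)"
  by (simp add: frechet_derivative_works)

lemma differentiable_cong_open:
  assumes "open S" "u \<in> S" "\<And>x. x \<in> S \<Longrightarrow> f x = g x"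
  shows "f differentiable (at u) \<longleftrightarrow> g differentiable (at u)"
  using assms has_derivative_transform_within_open[OF _ assms(1,2), of f _ UNIV g]
    has_derivative_transform_within_open[OF _ assms(1,2), of g _ UNIV f]
  unfolding differentiable_def by fastforce

lemma dir_deriv_cong_open:
  assumes "open S" "u \<in> S" "\<And>x. x \<in> S \<Longrightarrow> f x = g x"
  shows "dir_deriv f u v = dir_deriv g u v"
proof -
  have "(f has_derivative f') (at u) \<longleftrightarrow> (g has_derivative f') (at u)" for f'
    using assms has_derivative_transform_within_open[OF _ assms(1,2), of f f' UNIV g]
      has_derivative_transform_within_open[OF _ assms(1,2), of g f' UNIV f] by fastforce
  then show ?thesis
    by (simp add: frechet_derivative_def)
qed

lemma smooth_on_differentiable: "smooth_on S f \<Longrightarrow> u \<in> S \<Longrightarrow> f differentiable (at u)"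
  unfolding smooth_on_def by (metis Ck_on.simps(2))

lemma smooth_on_has_derivative:
  "smooth_on S f \<Longrightarrow> u \<in> S \<Longrightarrow> (f has_derivative dir_deriv f u) (at u)"
  by (simp add: dir_deriv_has_derivative smooth_on_differentiable)

lemma smooth_on_dir_deriv: "smooth_on S f \<Longrightarrow> smooth_on S (\<lambda>x. dir_deriv f x v)"
  unfolding smooth_on_def by (metis Ck_on.simps(2))

lemma smooth_on_continuous: "smooth_on S f \<Longrightarrow> continuous_on S f"
  unfolding smooth_on_def by (metis Ck_on.simps(1))

lemma smooth_on_subset:
  assumes "smooth_on S f" "T \<subseteq> S"
  shows "smooth_on T f"
proof -
  have "Ck_on k S h \<Longrightarrow> Ck_on k T h" for k and h :: "'a \<Rightarrow> 'b"
    using assms(2) by (induction k arbitrary: h) (auto intro: continuous_on_subset)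
  then show ?thesis
    using assms(1) by (simp add: smooth_on_def)
qed

lemma Ck_on_cong:
  assumes "open S" "\<And>x. x \<in> S \<Longrightarrow> f x = g x"
  shows "Ck_on k S f \<longleftrightarrow> Ck_on k S g"
  using assms(2)
proof (induction k arbitrary: f g)
  case 0
  then show ?case by (simp cong: continuous_on_cong)
next
  case (Suc k)
  have "Ck_on k S (\<lambda>x. dir_deriv f x v) \<longleftrightarrow> Ck_on k S (\<lambda>x. dir_deriv g x v)" for v
    using Suc.prems by (intro Suc.IH dir_deriv_cong_open[OF assms(1)]) auto
  moreover have "f differentiable (at x) \<longleftrightarrow> g differentiable (at x)" if "x \<in> S" for x
    using differentiable_cong_open[OF assms(1) that, of f g] Suc.prems by auto
  ultimately show ?case by simp
qed

lemma Ck_on_SucD: "Ck_on (Suc k) S f \<Longrightarrow> Ck_on k S f"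
proof (induction k arbitrary: f)
  case 0
  then show ?case
    by (auto intro!: differentiable_imp_continuous_on differentiable_at_imp_differentiable_on)
next
  case (Suc k)
  then show ?case by (metis Ck_on.simps(2))
qed

lemma Ck_on_add:
  assumes "open S" "Ck_on k S f" "Ck_on k S g"
  shows "Ck_on k S (\<lambda>x. f x + g x)"
  using assms(2,3)
proof (induction k arbitrary: f g)
  case 0
  then show ?case by (simp add: continuous_on_add)
next
  case (Suc k)
  have "Ck_on k S (\<lambda>x. dir_deriv (\<lambda>x. f x + g x) x v)
        \<longleftrightarrow> Ck_on k S (\<lambda>x. dir_deriv f x v + dir_deriv g x v)" for v
    using Suc.prems
    by (intro Ck_on_cong[OF assms(1)] dir_deriv_eqI has_derivative_add dir_deriv_has_derivative) auto
  then show ?case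
    using Suc by auto
qed

lemma Ck_on_mult:
  fixes f g :: "'v::real_normed_vector \<Rightarrow> real"
  assumes "open S" "Ck_on k S f" "Ck_on k S g"
  shows "Ck_on k S (\<lambda>x. f x * g x)"
  using assms(2,3)
proof (induction k arbitrary: f g)
  case 0
  then show ?case by (simp add: continuous_on_mult)
next
  case (Suc k)
  have "Ck_on k S (\<lambda>x. dir_deriv (\<lambda>x. f x * g x) x v)
        \<longleftrightarrow> Ck_on k S (\<lambda>x. f x * dir_deriv g x v + dir_deriv f x v * g x)" for v
    using Suc.prems
    by (intro Ck_on_cong[OF assms(1)] dir_deriv_eqI has_derivative_mult dir_deriv_has_derivative) auto
  moreover have "Ck_on k S (\<lambda>x. f x * dir_deriv g x v + dir_deriv f x v * g x)" for v
    using Suc.prems Suc.prems[THEN Ck_on_SucD] by (intro Ck_on_add Suc.IH assms(1)) auto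
  ultimately show ?case
    using Suc.prems by auto
qed

lemma Ck_on_exp:
  fixes f :: "'v::real_normed_vector \<Rightarrow> real"
  assumes "open S" "Ck_on k S f"
  shows "Ck_on k S (\<lambda>x. exp (f x))"
  using assms(2)
proof (induction k arbitrary: f)
  case 0
  then show ?case by (simp add: continuous_on_exp)
next
  case (Suc k)
  have D: "((\<lambda>x. exp (f x)) has_derivative (\<lambda>v. exp (f x) * dir_deriv f x v)) (at x)" if "x \<in> S" for x
    using has_derivative_exp[OF dir_deriv_has_derivative[of f x]] Suc.prems that
    by (simp add: mult.commute)
  then have "Ck_on k S (\<lambda>x. dir_deriv (\<lambda>x. exp (f x)) x v)
        \<longleftrightarrow> Ck_on k S (\<lambda>x. exp (f x) * dir_deriv f x v)" for v
    by (intro Ck_on_cong[OF assms(1)]) (simp add: dir_deriv_eqI[OF D])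
  moreover have "Ck_on k S (\<lambda>x. exp (f x) * dir_deriv f x v)" for v
    using Suc.prems Suc.prems[THEN Ck_on_SucD] by (intro Ck_on_mult Suc.IH assms(1)) auto
  ultimately show ?case
    using D unfolding Ck_on.simps differentiable_def by blast
qed

lemma Ck_on_const: "Ck_on k S (\<lambda>x. a)"
  by (induction k arbitrary: a) auto

lemma smooth_on_mult:
  fixes f g :: "'v::real_normed_vector \<Rightarrow> real"
  assumes "open S" "smooth_on S f" "smooth_on S g"
  shows "smooth_on S (\<lambda>x. f x * g x)"
  using assms by (simp add: smooth_on_def Ck_on_mult)

lemma smooth_on_exp:
  fixes f :: "'v::real_normed_vector \<Rightarrow> real"
  assumes "open S" "smooth_on S f"
  shows "smooth_on S (\<lambda>x. exp (f x))"
  using assms by (simp add: smooth_on_def Ck_on_exp)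

lemma smooth_on_const: "smooth_on S (\<lambda>x. a)"
  by (simp add: smooth_on_def Ck_on_const)

text \<open>Two applications of the mean value theorem turn the second difference quotient into a value of
  the second derivative at a nearby point.  The second difference itself is symmetric in the two
  directions, which is why this yields the symmetry of second derivatives.\<close>

lemma second_difference_approximates:
  fixes f :: "'v::real_normed_vector \<Rightarrow> real"
  assumes "open S" "smooth_on S f" "u \<in> S" "0 < e"
  shows "\<exists>d>0. \<forall>t. 0 < t \<and> t < d \<longrightarrow>
    \<bar>(f (u + t *\<^sub>R v + t *\<^sub>R w) - f (u + t *\<^sub>R v) - f (u + t *\<^sub>R w) + f u) / t\<^sup>2
       - dir_deriv (\<lambda>x. dir_deriv f x v) u w\<bar> < e"
proof -
  define H where "H = (\<lambda>x. dir_deriv (\<lambda>x. dir_deriv f x v) x w)"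
  have "continuous_on S H"
    unfolding H_def by (intro smooth_on_continuous smooth_on_dir_deriv assms)
  then have "isCont H u"
    using assms by (simp add: continuous_on_eq_continuous_at)
  then obtain r1 where r1: "r1 > 0" "\<And>x. dist x u < r1 \<Longrightarrow> dist (H x) (H u) < e"
    using assms(4) unfolding continuous_at_eps_delta by blast
  obtain r2 where r2: "r2 > 0" "ball u r2 \<subseteq> S"
    using assms open_contains_ball by blast
  define r where "r = min r1 r2"
  define d where "d = r / (norm v + norm w + 1)"
  have nz: "norm v + norm w + 1 > 0"
    using norm_ge_zero[of v] norm_ge_zero[of w] by linarith
  have "r > 0" "d > 0"
    using r1 r2 nz by (auto simp: r_def d_def)
  have near: "dist (u + s *\<^sub>R v + s' *\<^sub>R w) u < r"
    if "0 \<le> s" "s \<le> t" "0 \<le> s'" "s' \<le> t" "0 < t" "t < d" for s s' t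
  proof -
    have "norm (s *\<^sub>R v + s' *\<^sub>R w) \<le> s * norm v + s' * norm w"
      using norm_triangle_ineq[of "s *\<^sub>R v" "s' *\<^sub>R w"] that by simp
    also have "\<dots> \<le> t * norm v + t * norm w"
      using that by (intro add_mono mult_right_mono) auto
    also have "\<dots> < t * (norm v + norm w + 1)"
      using that by (simp add: algebra_simps)
    also have "\<dots> < d * (norm v + norm w + 1)"
      using that nz by (intro mult_strict_right_mono) auto
    also have "\<dots> = r"
      using nz by (simp add: d_def)
    finally show ?thesis
      by (simp add: dist_norm algebra_simps)
  qed
  have inS: "u + s *\<^sub>R v + s' *\<^sub>R w \<in> S"
    if "0 \<le> s" "s \<le> t" "0 \<le> s'" "s' \<le> t" "0 < t" "t < d" for s s' t
    using near[OF that] r2 by (auto simp: r_def dist_commute)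
  have line: "((\<lambda>s. h (a + s *\<^sub>R b)) has_real_derivative dir_deriv h (a + s *\<^sub>R b) b) (at s)"
    if "smooth_on S h" "a + s *\<^sub>R b \<in> S" for h :: "'v \<Rightarrow> real" and a b s
  proof -
    have "((\<lambda>s. a + s *\<^sub>R b) has_derivative (\<lambda>t. t *\<^sub>R b)) (at s)"
      by (auto intro!: derivative_eq_intros)
    from diff_chain_at[OF this smooth_on_has_derivative[OF that]]
    have "((\<lambda>s. h (a + s *\<^sub>R b)) has_derivative (\<lambda>t. dir_deriv h (a + s *\<^sub>R b) (t *\<^sub>R b))) (at s)"
      by (simp add: o_def)
    moreover have "dir_deriv h (a + s *\<^sub>R b) (t *\<^sub>R b) = dir_deriv h (a + s *\<^sub>R b) b * t" for t
      using linear_frechet_derivative[OF smooth_on_differentiable[OF that]]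
      by (simp add: linear_cmul mult.commute)
    ultimately show ?thesis
      by (simp add: has_field_derivative_def)
  qed
  have "\<bar>(f (u + t *\<^sub>R v + t *\<^sub>R w) - f (u + t *\<^sub>R v) - f (u + t *\<^sub>R w) + f u) / t\<^sup>2 - H u\<bar> < e"
    if t: "0 < t" "t < d" for t
  proof -
    define \<phi> where "\<phi> = (\<lambda>s. f ((u + t *\<^sub>R w) + s *\<^sub>R v) - f (u + s *\<^sub>R v))"
    have "(\<phi> has_real_derivative
        dir_deriv f ((u + t *\<^sub>R w) + s *\<^sub>R v) v - dir_deriv f (u + s *\<^sub>R v) v) (at s)"
      if "0 \<le> s" "s \<le> t" for s
      using that t inS[of s t t] inS[of s t 0] unfolding \<phi>_def
      by (intro DERIV_diff line assms) (auto simp: add_ac)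
    from MVT2[OF t(1) this] obtain z where z: "0 < z" "z < t" and
      \<phi>: "\<phi> t - \<phi> 0 = t * (dir_deriv f ((u + t *\<^sub>R w) + z *\<^sub>R v) v - dir_deriv f (u + z *\<^sub>R v) v)"
      by auto
    have "((\<lambda>s. dir_deriv f ((u + z *\<^sub>R v) + s *\<^sub>R w) v) has_real_derivative
        H ((u + z *\<^sub>R v) + s *\<^sub>R w)) (at s)"
      if "0 \<le> s" "s \<le> t" for s
      unfolding H_def using that t z inS[of z t s]
      by (intro line[where h = "\<lambda>x. dir_deriv f x v"] smooth_on_dir_deriv assms) auto
    from MVT2[OF t(1) this] obtain y where y: "0 < y" "y < t" and
      \<psi>: "dir_deriv f ((u + z *\<^sub>R v) + t *\<^sub>R w) v - dir_deriv f (u + z *\<^sub>R v) v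
          = t * H ((u + z *\<^sub>R v) + y *\<^sub>R w)"
      by auto
    have "\<phi> t - \<phi> 0 = t * (t * H (u + z *\<^sub>R v + y *\<^sub>R w))"
      using \<phi> \<psi> by (simp add: add_ac)
    moreover have "\<phi> t - \<phi> 0
        = f (u + t *\<^sub>R v + t *\<^sub>R w) - f (u + t *\<^sub>R v) - f (u + t *\<^sub>R w) + f u"
      by (simp add: \<phi>_def add_ac)
    ultimately have "(f (u + t *\<^sub>R v + t *\<^sub>R w) - f (u + t *\<^sub>R v) - f (u + t *\<^sub>R w) + f u) / t\<^sup>2
        = H (u + z *\<^sub>R v + y *\<^sub>R w)"
      using t by (simp add: power2_eq_square)
    then show ?thesis
      using r1(2)[of "u + z *\<^sub>R v + y *\<^sub>R w"] near[of z t y] z y t by (simp add: r_def dist_real_def)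
  qed
  then show ?thesis
    using \<open>d > 0\<close> by (auto simp: H_def)
qed

lemma second_deriv_symmetric_real:
  fixes f :: "'v::real_normed_vector \<Rightarrow> real"
  assumes "open S" "smooth_on S f" "u \<in> S"
  shows "dir_deriv (\<lambda>x. dir_deriv f x v) u w = dir_deriv (\<lambda>x. dir_deriv f x w) u v"
    (is "?a = ?b")
proof (rule ccontr)
  assume "?a \<noteq> ?b"
  then have e: "\<bar>?a - ?b\<bar> / 2 > 0" by simp
  let ?q = "\<lambda>v w t. (f (u + t *\<^sub>R v + t *\<^sub>R w) - f (u + t *\<^sub>R v) - f (u + t *\<^sub>R w) + f u) / t\<^sup>2"
  obtain d1 where d1: "d1 > 0" "\<And>t. 0 < t \<and> t < d1 \<longrightarrow> \<bar>?q v w t - ?a\<bar> < \<bar>?a - ?b\<bar> / 2"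
    using second_difference_approximates[OF assms e, of v w] by blast
  obtain d2 where d2: "d2 > 0" "\<And>t. 0 < t \<and> t < d2 \<longrightarrow> \<bar>?q w v t - ?b\<bar> < \<bar>?a - ?b\<bar> / 2"
    using second_difference_approximates[OF assms e, of w v] by blast
  define t where "t = min d1 d2 / 2"
  have "0 < t" "t < d1" "t < d2"
    using d1(1) d2(1) by (auto simp: t_def)
  then have "\<bar>?q v w t - ?a\<bar> < \<bar>?a - ?b\<bar> / 2" "\<bar>?q w v t - ?b\<bar> < \<bar>?a - ?b\<bar> / 2"
    using d1(2) d2(2) by blast+
  moreover have "?q v w t = ?q w v t"
    by (simp add: add_ac)
  moreover have "\<not> (\<bar>q - a\<bar> < \<bar>a - b\<bar> / 2 \<and> \<bar>q - b\<bar> < \<bar>a - b\<bar> / 2)" for q a b :: real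
    by (smt (verit) field_sum_of_halves)
  ultimately show False
    by metis
qed

lemma dir_deriv_inner:
  assumes "f differentiable (at x)"
  shows "dir_deriv (\<lambda>x. f x \<bullet> b) x v = dir_deriv f x v \<bullet> b"
  by (intro dir_deriv_eqI has_derivative_inner_left dir_deriv_has_derivative assms)

lemma smooth_on_inner:
  fixes f :: "'v::real_normed_vector \<Rightarrow> 'w::euclidean_space"
  assumes "open S" "smooth_on S f"
  shows "smooth_on S (\<lambda>x. f x \<bullet> b)"
proof -
  have "Ck_on k S (\<lambda>x. h x \<bullet> b)" if "Ck_on k S h" for k and h :: "'v \<Rightarrow> 'w"
    using that
  proof (induction k arbitrary: h)
    case 0
    then show ?case by (auto intro!: continuous_intros)
  next
    case (Suc k)
    have "Ck_on k S (\<lambda>x. dir_deriv (\<lambda>x. h x \<bullet> b) x v) \<longleftrightarrow> Ck_on k S (\<lambda>x. dir_deriv h x v \<bullet> b)" for v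
      using Suc.prems by (intro Ck_on_cong[OF assms(1)] dir_deriv_inner) auto
    then show ?case
      using Suc by auto
  qed
  then show ?thesis
    using assms(2) by (simp add: smooth_on_def)
qed

lemma second_deriv_symmetric:
  fixes f :: "'v::real_normed_vector \<Rightarrow> 'w::euclidean_space"
  assumes "open S" "smooth_on S f" "u \<in> S"
  shows "dir_deriv (\<lambda>x. dir_deriv f x v) u w = dir_deriv (\<lambda>x. dir_deriv f x w) u v"
proof (rule euclidean_eqI)
  fix b :: 'w
  have D: "dir_deriv (\<lambda>x. dir_deriv f x a) u a' \<bullet> b
      = dir_deriv (\<lambda>x. dir_deriv (\<lambda>x. f x \<bullet> b) x a) u a'" for a a'
  proof -
    have "dir_deriv (\<lambda>x. dir_deriv f x a) u a' \<bullet> b = dir_deriv (\<lambda>x. dir_deriv f x a \<bullet> b) u a'"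
      by (intro dir_deriv_inner[symmetric] smooth_on_differentiable[of S] smooth_on_dir_deriv assms)
    also have "\<dots> = dir_deriv (\<lambda>x. dir_deriv (\<lambda>x. f x \<bullet> b) x a) u a'"
      using assms
      by (intro dir_deriv_cong_open[of S]) (auto simp: dir_deriv_inner smooth_on_differentiable)
    finally show ?thesis .
  qed
  show "dir_deriv (\<lambda>x. dir_deriv f x v) u w \<bullet> b = dir_deriv (\<lambda>x. dir_deriv f x w) u v \<bullet> b"
    unfolding D by (intro second_deriv_symmetric_real[of S] smooth_on_inner assms)
qed

section \<open>Nondegenerate forms and differentiable families of forms\<close>

lemmas bilinear_simps =
  bilinear_ladd bilinear_radd bilinear_lsub bilinear_rsub bilinear_lmul bilinear_rmul
  bilinear_lneg bilinear_rneg bilinear_lzero bilinear_rzero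

definition nondegenerate_symmetric :: "'v::real_vector form2 \<Rightarrow> bool" where
  "nondegenerate_symmetric b \<longleftrightarrow>
     bilinear b \<and> (\<forall>v w. b v w = b w v) \<and> (\<forall>v. (\<forall>w. b v w = 0) \<longrightarrow> v = 0)"

lemma nondegenerate_symmetricD:
  assumes "nondegenerate_symmetric b"
  shows "bilinear b" "b v w = b w v" "(\<And>w. b v w = 0) \<Longrightarrow> v = 0"
  using assms by (auto simp: nondegenerate_symmetric_def)

lemma nondegenerate_eqI:
  assumes "nondegenerate_symmetric b" "\<And>w. b v w = b v' w"
  shows "v = v'"
proof -
  have "b (v - v') w = 0" for w
    using assms nondegenerate_symmetricD(1)[OF assms(1)] by (simp add: bilinear_simps)
  then show ?thesis
    using nondegenerate_symmetricD(3)[OF assms(1), of "v - v'"] by simp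
qed

lemma linear_axis_sum:
  fixes \<phi> :: "real ^ 'n::finite \<Rightarrow> 'w::real_vector"
  assumes "linear \<phi>"
  shows "\<phi> v = (\<Sum>i\<in>UNIV. v $ i *\<^sub>R \<phi> (axis i 1))"
proof -
  have "\<phi> v = \<phi> (\<Sum>i\<in>UNIV. v $ i *\<^sub>R axis i 1)"
    by (simp add: basis_expansion flip: scalar_mult_eq_scaleR)
  then show ?thesis
    by (simp add: linear_sum[OF assms] linear_cmul[OF assms])
qed

lemma linear_eq_on_axis:
  fixes \<phi> \<psi> :: "real ^ 'n::finite \<Rightarrow> 'w::real_vector"
  assumes "linear \<phi>" "linear \<psi>" "\<And>i. \<phi> (axis i 1) = \<psi> (axis i 1)"
  shows "\<phi> v = \<psi> v"
  using linear_axis_sum[OF assms(1), of v] linear_axis_sum[OF assms(2), of v] assms(3) by simp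

lemma nondegenerate_represents:
  fixes b :: "(real ^ 'n::finite) form2"
  assumes b: "nondegenerate_symmetric b" and "linear \<phi>"
  obtains v where "\<And>w. b v w = \<phi> w"
proof -
  note bil = nondegenerate_symmetricD(1)[OF b]
  have lin: "linear (\<lambda>w. b v w)" for v
    using bil by (simp add: bilinear_def)
  define L where "L = (\<lambda>v. \<chi> i. b v (axis i 1))"
  have "linear L"
    by (rule linearI) (simp_all add: L_def vec_eq_iff bilinear_simps[OF bil])
  moreover have "inj L"
  proof (rule injI)
    fix v v' assume "L v = L v'"
    then have "b v (axis i 1) = b v' (axis i 1)" for i
      by (simp add: L_def vec_eq_iff)
    then show "v = v'"
      by (metis nondegenerate_eqI[OF b] linear_eq_on_axis[OF lin lin])
  qed
  ultimately have "surj L"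
    by (simp add: linear_injective_imp_surjective)
  then obtain v where "L v = (\<chi> i. \<phi> (axis i 1))"
    by (metis surjD)
  then have "b v (axis i 1) = \<phi> (axis i 1)" for i
    by (simp add: L_def vec_eq_iff)
  then have "b v w = \<phi> w" for w
    by (rule linear_eq_on_axis[OF lin assms(2)])
  then show ?thesis using that by blast
qed

lemma form_operator_unique:
  assumes b: "nondegenerate_symmetric b" and L: "\<And>x y. b (L x) y = B x y"
  shows "form_operator b B = L"
  unfolding form_operator_def
proof (rule the_equality)
  fix L' assume "\<forall>x y. b (L' x) y = B x y"
  then show "L' = L"
    using L by (intro ext nondegenerate_eqI[OF b]) simp
qed (simp add: L)

lemma form_operator_eq:
  fixes b :: "(real ^ 'n::finite) form2"
  assumes b: "nondegenerate_symmetric b" and B: "bilinear B"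
  shows "b (form_operator b B x) y = B x y"
proof -
  have "\<exists>v. \<forall>w. b v w = B x w" for x
    using nondegenerate_represents[OF b, of "B x"] B by (metis bilinear_def)
  then obtain L where "\<And>x w. b (L x) w = B x w"
    by metis
  with form_operator_unique[OF b, of L B] show ?thesis
    by simp
qed

lemma linear_form_operator:
  fixes b :: "(real ^ 'n::finite) form2"
  assumes b: "nondegenerate_symmetric b" and B: "bilinear B"
  shows "linear (form_operator b B)"
proof (rule linearI)
  note simps = form_operator_eq[OF b B] bilinear_simps[OF B]
    bilinear_simps[OF nondegenerate_symmetricD(1)[OF b]]
  show "form_operator b B (x + y) = form_operator b B x + form_operator b B y" for x y
    by (rule nondegenerate_eqI[OF b]) (simp add: simps)
  show "form_operator b B (r *\<^sub>R x) = r *\<^sub>R form_operator b B x" for r x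
    by (rule nondegenerate_eqI[OF b]) (simp add: simps)
qed

text \<open>The product rule for a form applied to two fields. Expanding both fields in bases reduces it to
  the product rule for real functions; only the values of the form on fixed vectors are then
  differentiated.\<close>

lemma has_derivative_form_family:
  fixes \<beta> :: "'u::real_normed_vector \<Rightarrow> 'a::euclidean_space \<Rightarrow> 'b::euclidean_space \<Rightarrow>
    'w::real_normed_vector"
  assumes S: "open S" "u \<in> S" and bil: "\<And>x. x \<in> S \<Longrightarrow> bilinear (\<beta> x)"
    and diff: "\<And>a b. (\<lambda>x. \<beta> x a b) differentiable (at u)"
    and Y: "(Y has_derivative Y') (at u)" and Z: "(Z has_derivative Z') (at u)"
  shows "((\<lambda>x. \<beta> x (Y x) (Z x)) has_derivative
    (\<lambda>h. dir_deriv (\<lambda>x. \<beta> x (Y u) (Z u)) u h + \<beta> u (Y' h) (Z u) + \<beta> u (Y u) (Z' h))) (at u)"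
proof -
  let ?e = "\<lambda>x i j. \<beta> x i j"
  have expand: "\<beta> x a b = (\<Sum>i\<in>Basis. \<Sum>j\<in>Basis. (a \<bullet> i * (b \<bullet> j)) *\<^sub>R ?e x i j)" if "x \<in> S" for x a b
  proof -
    have "\<beta> x a b = \<beta> x (\<Sum>i\<in>Basis. (a \<bullet> i) *\<^sub>R i) (\<Sum>j\<in>Basis. (b \<bullet> j) *\<^sub>R j)"
      by (simp add: euclidean_representation)
    also have "\<dots> = (\<Sum>i\<in>Basis. \<Sum>j\<in>Basis. (a \<bullet> i * (b \<bullet> j)) *\<^sub>R ?e x i j)"
      by (simp add: bilinear_sum[OF bil[OF that]] bilinear_simps[OF bil[OF that]]
          sum.cartesian_product split_def mult.commute)
    finally show ?thesis .
  qed
  define E where "E = (\<lambda>i j. dir_deriv (\<lambda>x. ?e x i j) u)"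
  have E: "((\<lambda>x. ?e x i j) has_derivative E i j) (at u)" for i j
    unfolding E_def by (rule dir_deriv_has_derivative[OF diff])
  have yi: "((\<lambda>x. Y x \<bullet> i) has_derivative (\<lambda>h. Y' h \<bullet> i)) (at u)" for i
    by (rule has_derivative_inner_left[OF Y])
  have zj: "((\<lambda>x. Z x \<bullet> j) has_derivative (\<lambda>h. Z' h \<bullet> j)) (at u)" for j
    by (rule has_derivative_inner_left[OF Z])
  have "((\<lambda>x. \<Sum>i\<in>Basis. \<Sum>j\<in>Basis. (Y x \<bullet> i * (Z x \<bullet> j)) *\<^sub>R ?e x i j) has_derivative
     (\<lambda>h. \<Sum>i\<in>Basis. \<Sum>j\<in>Basis. (Y u \<bullet> i * (Z u \<bullet> j)) *\<^sub>R E i j h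
        + (Y u \<bullet> i * (Z' h \<bullet> j) + Y' h \<bullet> i * (Z u \<bullet> j)) *\<^sub>R ?e u i j)) (at u)"
    by (intro has_derivative_sum has_derivative_scaleR has_derivative_mult yi zj E)
  then have main: "((\<lambda>x. \<beta> x (Y x) (Z x)) has_derivative
     (\<lambda>h. \<Sum>i\<in>Basis. \<Sum>j\<in>Basis. (Y u \<bullet> i * (Z u \<bullet> j)) *\<^sub>R E i j h
        + (Y u \<bullet> i * (Z' h \<bullet> j) + Y' h \<bullet> i * (Z u \<bullet> j)) *\<^sub>R ?e u i j)) (at u)"
    by (rule has_derivative_transform_within_open[OF _ S]) (rule expand[symmetric])
  have const: "dir_deriv (\<lambda>x. \<beta> x a b) u h = (\<Sum>i\<in>Basis. \<Sum>j\<in>Basis. (a \<bullet> i * (b \<bullet> j)) *\<^sub>R E i j h)"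
    for a b h
  proof -
    have "((\<lambda>x. \<Sum>i\<in>Basis. \<Sum>j\<in>Basis. (a \<bullet> i * (b \<bullet> j)) *\<^sub>R ?e x i j) has_derivative
       (\<lambda>h. \<Sum>i\<in>Basis. \<Sum>j\<in>Basis. (a \<bullet> i * (b \<bullet> j)) *\<^sub>R E i j h)) (at u)"
      by (intro has_derivative_sum has_derivative_scaleR_right E)
    then have "((\<lambda>x. \<beta> x a b) has_derivative
       (\<lambda>h. \<Sum>i\<in>Basis. \<Sum>j\<in>Basis. (a \<bullet> i * (b \<bullet> j)) *\<^sub>R E i j h)) (at u)"
      by (rule has_derivative_transform_within_open[OF _ S]) (rule expand[symmetric])
    then show ?thesis
      by (rule dir_deriv_eqI)
  qed
  show ?thesis
  proof (rule has_derivative_eq_rhs[OF main], rule ext)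
    fix h
    show "(\<Sum>i\<in>Basis. \<Sum>j\<in>Basis. (Y u \<bullet> i * (Z u \<bullet> j)) *\<^sub>R E i j h
        + (Y u \<bullet> i * (Z' h \<bullet> j) + Y' h \<bullet> i * (Z u \<bullet> j)) *\<^sub>R ?e u i j)
      = dir_deriv (\<lambda>x. \<beta> x (Y u) (Z u)) u h + \<beta> u (Y' h) (Z u) + \<beta> u (Y u) (Z' h)"
      unfolding const expand[OF S(2), of "Y' h" "Z u"] expand[OF S(2), of "Y u" "Z' h"]
      by (simp add: sum.distrib scaleR_add_left)
  qed
qed

text \<open>By Cramer's rule a vector field depends on its products with the constant fields through
  rational functions with nonvanishing denominator.\<close>

lemma differentiable_represented_field:
  fixes b :: "'u::real_normed_vector \<Rightarrow> (real ^ 'n::finite) form2"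
  assumes S: "open S" "u \<in> S" and b: "\<And>x. x \<in> S \<Longrightarrow> nondegenerate_symmetric (b x)"
    and diff: "\<And>v w. (\<lambda>x. b x v w) differentiable (at u)"
    and prod: "\<And>w. (\<lambda>x. b x (X x) w) differentiable (at u)"
  shows "X differentiable (at u)"
proof -
  define A where "A = (\<lambda>x. (\<chi> i j. b x (axis j 1) (axis i 1)) :: real^'n^'n)"
  define p where "p = (\<lambda>x. (\<chi> i. b x (X x) (axis i 1)) :: real^'n)"
  have mult: "A x *v v = (\<chi> i. b x v (axis i 1))" if "x \<in> S" for x v
  proof -
    have "linear (\<lambda>v. b x v w)" for w
      using nondegenerate_symmetricD(1)[OF b[OF that]] by (simp add: bilinear_def)
    from linear_axis_sum[OF this, of v] show ?thesis
      by (simp add: vec_eq_iff A_def matrix_vector_mult_def mult.commute)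
  qed
  have det: "det (A x) \<noteq> 0" if x: "x \<in> S" for x
  proof -
    have "inj ((*v) (A x))"
    proof (rule injI)
      fix v v' assume "A x *v v = A x *v v'"
      then have eq: "b x v (axis i 1) = b x v' (axis i 1)" for i
        by (simp add: mult[OF x] vec_eq_iff)
      have lin: "linear (b x v)" for v
        using nondegenerate_symmetricD(1)[OF b[OF x]] by (simp add: bilinear_def)
      show "v = v'"
        by (metis nondegenerate_eqI[OF b[OF x]] linear_eq_on_axis[OF lin lin] eq)
    qed
    then show ?thesis
      using det_nz_iff_inj[OF matrix_vector_mul_linear[of "A x"]] by simp
  qed
  have X: "X x = (\<chi> k. det (\<chi> i j. if j = k then p x $ i else A x $ i $ j) / det (A x))" if "x \<in> S" for x
    using cramer[OF det[OF that], of "X x" "p x"] mult[OF that] by (simp add: p_def)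
  have dA: "(\<lambda>x. A x $ i $ j) differentiable (at u)" for i j
    by (simp add: A_def diff)
  have dp: "(\<lambda>x. p x $ i) differentiable (at u)" for i
    by (simp add: p_def prod)
  have ddet: "(\<lambda>x. det (C x)) differentiable (at u)"
    if "\<And>i j. (\<lambda>x. C x $ i $ j) differentiable (at u)" for C :: "'u \<Rightarrow> real^'n^'n"
  proof -
    have "\<And>i j. \<exists>D. ((\<lambda>x. C x $ i $ j) has_derivative D) (at u)"
      using that by (simp add: differentiable_def)
    then obtain D where D: "\<And>i j. ((\<lambda>x. C x $ i $ j) has_derivative D i j) (at u)"
      by metis
    show ?thesis
      unfolding det_def differentiable_def
      by (rule exI, rule has_derivative_sum, rule has_derivative_mult_right, rule has_derivative_prod,
          rule D)
  qed
  have "(\<lambda>x. if j = k then p x $ i else A x $ i $ j) differentiable (at u)" for i j k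
    by (cases "j = k") (simp_all add: dA dp)
  then have comp: "(\<lambda>x. det (\<chi> i j. if j = k then p x $ i else A x $ i $ j) / det (A x)) differentiable (at u)"
    for k
    by (intro differentiable_divide ddet dA det S) simp
  have "(\<lambda>x. \<chi> k. det (\<chi> i j. if j = k then p x $ i else A x $ i $ j) / det (A x)) differentiable (at u)"
    by (subst differentiable_componentwise_within) (use comp in \<open>auto simp: Basis_vec_def inner_axis\<close>)
  then show ?thesis
    using differentiable_cong_open[OF S X] by simp
qed

section \<open>The Levi-Civita connection and its curvature\<close>

definition smooth_metric_on ::
  "(real ^ 'n) set \<Rightarrow> (real ^ 'n \<Rightarrow> (real ^ 'n::finite) form2) \<Rightarrow> bool" where
  "smooth_metric_on S \<gamma> \<longleftrightarrow>
     open S \<and> (\<forall>u\<in>S. nondegenerate_symmetric (\<gamma> u)) \<and> (\<forall>v w. smooth_on S (\<lambda>u. \<gamma> u v w))"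

lemma smooth_metric_onD:
  assumes "smooth_metric_on S \<gamma>"
  shows "open S" "u \<in> S \<Longrightarrow> nondegenerate_symmetric (\<gamma> u)"
    "u \<in> S \<Longrightarrow> bilinear (\<gamma> u)" "u \<in> S \<Longrightarrow> \<gamma> u v w = \<gamma> u w v"
    "smooth_on S (\<lambda>u. \<gamma> u v w)" "u \<in> S \<Longrightarrow> (\<lambda>u. \<gamma> u v w) differentiable (at u)"
  using assms smooth_on_differentiable[of S "\<lambda>u. \<gamma> u v w" u]
  by (simp_all add: smooth_metric_on_def nondegenerate_symmetric_def)

lemma bilinear_metric_deriv:
  assumes \<gamma>: "smooth_metric_on S \<gamma>" and u: "u \<in> S"
  shows "bilinear (\<lambda>v w. dir_deriv (\<lambda>u. \<gamma> u v w) u x)"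
proof -
  note D = dir_deriv_has_derivative[OF smooth_metric_onD(6)[OF \<gamma> u]]
  note S = smooth_metric_onD(1)[OF \<gamma>] u
  note bil = smooth_metric_onD(3)[OF \<gamma>]
  have "dir_deriv (\<lambda>u. \<gamma> u (v + v') w) u x = dir_deriv (\<lambda>u. \<gamma> u v w) u x + dir_deriv (\<lambda>u. \<gamma> u v' w) u x"
    for v v' w
    by (rule dir_deriv_eqI[OF has_derivative_transform_within_open[OF has_derivative_add[OF D D] S]])
      (simp add: bilinear_simps[OF bil])
  moreover have "dir_deriv (\<lambda>u. \<gamma> u (r *\<^sub>R v) w) u x = r *\<^sub>R dir_deriv (\<lambda>u. \<gamma> u v w) u x" for r v w
    by (rule dir_deriv_eqI[OF has_derivative_transform_within_open[OF has_derivative_scaleR_right[OF D] S]])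
      (simp add: bilinear_simps[OF bil])
  moreover have "dir_deriv (\<lambda>u. \<gamma> u v w) u x = dir_deriv (\<lambda>u. \<gamma> u w v) u x" for v w
    using smooth_metric_onD(4)[OF \<gamma>] by (intro dir_deriv_cong_open[OF S]) auto
  ultimately show ?thesis
    unfolding bilinear_def by (intro conjI allI linearI) (metis (no_types))+
qed

lemma metric_deriv_symmetric:
  assumes \<gamma>: "smooth_metric_on S \<gamma>" and u: "u \<in> S"
  shows "dir_deriv (\<lambda>u. \<gamma> u v w) u x = dir_deriv (\<lambda>u. \<gamma> u w v) u x"
  using smooth_metric_onD[OF \<gamma>] u by (intro dir_deriv_cong_open[of S]) auto

text \<open>The right-hand side of the Koszul formula for \<open>\<gamma> (\<nabla>\<^bsub>y\<^esub> z) w\<close> on constant fields.\<close>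

definition koszul ::
  "(real ^ 'n \<Rightarrow> (real ^ 'n::finite) form2) \<Rightarrow> real ^ 'n \<Rightarrow> real ^ 'n \<Rightarrow> real ^ 'n \<Rightarrow> real ^ 'n \<Rightarrow> real" where
  "koszul \<gamma> u y z w =
     (dir_deriv (\<lambda>u. \<gamma> u z w) u y + dir_deriv (\<lambda>u. \<gamma> u y w) u z - dir_deriv (\<lambda>u. \<gamma> u y z) u w) / 2"

text \<open>The usual permutation of three instances of the metric condition. It characterizes the
  Levi-Civita connection by a formula for all \<open>\<gamma> (\<Gamma> y z) w\<close>, from which existence, uniqueness,
  bilinearity and differentiability follow.\<close>

lemma connection_iff_koszul:
  assumes \<gamma>: "smooth_metric_on S \<gamma>" and u: "u \<in> S"
  shows "(\<forall>x y. \<Gamma> x y = \<Gamma> y x) \<and>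
      (\<forall>x y z. dir_deriv (\<lambda>u. \<gamma> u y z) u x = \<gamma> u (\<Gamma> x y) z + \<gamma> u y (\<Gamma> x z))
    \<longleftrightarrow> (\<forall>y z w. \<gamma> u (\<Gamma> y z) w = koszul \<gamma> u y z w)" (is "?L \<longleftrightarrow> ?R")
proof
  assume L: ?L
  then have sym: "\<Gamma> x y = \<Gamma> y x" and
    comp: "dir_deriv (\<lambda>u. \<gamma> u y z) u x = \<gamma> u (\<Gamma> x y) z + \<gamma> u y (\<Gamma> x z)" for x y z
    by blast+
  show ?R
  proof (intro allI)
    fix y z w
    show "\<gamma> u (\<Gamma> y z) w = koszul \<gamma> u y z w"
      unfolding koszul_def comp
      using sym[of z y] sym[of w y] sym[of w z] smooth_metric_onD(4)[OF \<gamma> u]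
      by (simp add: field_simps)
  qed
next
  assume R: ?R
  note sym = smooth_metric_onD(4)[OF \<gamma> u]
  have K: "\<gamma> u (\<Gamma> y z) w = koszul \<gamma> u y z w" for y z w
    using R by blast
  have K': "\<gamma> u w (\<Gamma> y z) = koszul \<gamma> u y z w" for y z w
    using K sym by metis
  note dsym = metric_deriv_symmetric[OF \<gamma> u]
  show ?L
  proof (intro conjI allI)
    fix x y
    show "\<Gamma> x y = \<Gamma> y x"
      using dsym[of x y]
      by (intro nondegenerate_eqI[OF smooth_metric_onD(2)[OF \<gamma> u]]) (simp add: K koszul_def)
  next
    fix x y z
    show "dir_deriv (\<lambda>u. \<gamma> u y z) u x = \<gamma> u (\<Gamma> x y) z + \<gamma> u y (\<Gamma> x z)"
      using dsym[of y z x] dsym[of x z y] dsym[of x y z]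
      by (simp add: K K' koszul_def field_simps)
  qed
qed

lemma
  assumes \<gamma>: "smooth_metric_on S \<gamma>" and u: "u \<in> S"
  shows bilinear_christoffel: "bilinear (christoffel \<gamma> u)"
    and christoffel_koszul: "\<gamma> u (christoffel \<gamma> u y z) w = koszul \<gamma> u y z w"
proof -
  note nd = smooth_metric_onD(2)[OF \<gamma> u] and bil = smooth_metric_onD(3)[OF \<gamma> u]
  note dbil = bilinear_metric_deriv[OF \<gamma> u]
  note dlin = linear_frechet_derivative[OF smooth_metric_onD(6)[OF \<gamma> u]]
  have lin: "linear (koszul \<gamma> u y z)" for y z
    unfolding koszul_def
    by (rule linearI)
      (simp_all add: bilinear_simps[OF dbil] linear_add[OF dlin] linear_cmul[OF dlin] field_simps)
  have "\<exists>v. \<forall>w. \<gamma> u v w = koszul \<gamma> u y z w" for y z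
    using nondegenerate_represents[OF nd lin[of y z]] by blast
  then obtain \<Gamma> where \<Gamma>: "\<And>y z w. \<gamma> u (\<Gamma> y z) w = koszul \<gamma> u y z w"
    by metis
  have bil\<Gamma>: "bilinear \<Gamma>"
    unfolding bilinear_def
    by (intro conjI allI linearI nondegenerate_eqI[OF nd])
      (simp_all add: \<Gamma> bilinear_simps[OF bil] koszul_def bilinear_simps[OF dbil]
        linear_add[OF dlin] linear_cmul[OF dlin] field_simps)
  have "christoffel \<gamma> u = \<Gamma>"
    unfolding christoffel_def
  proof (rule the_equality)
    show "bilinear \<Gamma> \<and> (\<forall>x y. \<Gamma> x y = \<Gamma> y x) \<and>
        (\<forall>x y z. frechet_derivative (\<lambda>u. \<gamma> u y z) (at u) x = \<gamma> u (\<Gamma> x y) z + \<gamma> u y (\<Gamma> x z))"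
      using bil\<Gamma> \<Gamma> connection_iff_koszul[OF \<gamma> u, of \<Gamma>] by blast
  next
    fix \<Gamma>'
    assume "bilinear \<Gamma>' \<and> (\<forall>x y. \<Gamma>' x y = \<Gamma>' y x) \<and>
        (\<forall>x y z. frechet_derivative (\<lambda>u. \<gamma> u y z) (at u) x = \<gamma> u (\<Gamma>' x y) z + \<gamma> u y (\<Gamma>' x z))"
    then have "\<gamma> u (\<Gamma>' y z) w = koszul \<gamma> u y z w" for y z w
      using connection_iff_koszul[OF \<gamma> u, of \<Gamma>'] by blast
    then show "\<Gamma>' = \<Gamma>"
      using \<Gamma> by (intro ext nondegenerate_eqI[OF nd]) simp
  qed
  then show "bilinear (christoffel \<gamma> u)" "\<gamma> u (christoffel \<gamma> u y z) w = koszul \<gamma> u y z w"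
    using bil\<Gamma> \<Gamma> by simp_all
qed

lemma
  assumes \<gamma>: "smooth_metric_on S \<gamma>" and u: "u \<in> S"
  shows christoffel_symmetric: "christoffel \<gamma> u x y = christoffel \<gamma> u y x"
    and christoffel_metric: "dir_deriv (\<lambda>u. \<gamma> u y z) u x
      = \<gamma> u (christoffel \<gamma> u x y) z + \<gamma> u y (christoffel \<gamma> u x z)"
  using connection_iff_koszul[OF \<gamma> u, of "christoffel \<gamma> u"] christoffel_koszul[OF \<gamma> u] by blast+

lemma differentiable_koszul:
  assumes \<gamma>: "smooth_metric_on S \<gamma>" and u: "u \<in> S"
  shows "(\<lambda>u. koszul \<gamma> u y z w) differentiable (at u)"
proof -
  have "(\<lambda>u. dir_deriv (\<lambda>u. \<gamma> u v w) u x) differentiable (at u)" for v w x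
    using smooth_on_differentiable[OF smooth_on_dir_deriv[OF smooth_metric_onD(5)[OF \<gamma>]] u] .
  then show ?thesis
    unfolding koszul_def by (intro differentiable_divide differentiable_diff differentiable_add) auto
qed

lemma differentiable_christoffel:
  assumes \<gamma>: "smooth_metric_on S \<gamma>" and u: "u \<in> S"
  shows "(\<lambda>u. christoffel \<gamma> u y z) differentiable (at u)"
proof (rule differentiable_represented_field[where b = \<gamma> and S = S])
  fix w
  show "(\<lambda>u. \<gamma> u (christoffel \<gamma> u y z) w) differentiable (at u)"
    using differentiable_cong_open[OF smooth_metric_onD(1)[OF \<gamma>] u,
        of "\<lambda>u. \<gamma> u (christoffel \<gamma> u y z) w" "\<lambda>u. koszul \<gamma> u y z w"]
      christoffel_koszul[OF \<gamma>] differentiable_koszul[OF \<gamma> u] by simp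
qed (use smooth_metric_onD[OF \<gamma>] u in auto)

text \<open>Metric compatibility for fields along a map; the identity map gives the intrinsic version.\<close>

lemma has_derivative_metric_along:
  assumes \<gamma>: "smooth_metric_on S \<gamma>" and W: "open W" "u \<in> W" "F ` W \<subseteq> S"
    and F: "F differentiable (at u)" and Y: "Y differentiable (at u)" and Z: "Z differentiable (at u)"
  shows "((\<lambda>x. \<gamma> (F x) (Y x) (Z x)) has_derivative
    (\<lambda>v. \<gamma> (F u) (cov_deriv_along \<gamma> F v Y u) (Z u) + \<gamma> (F u) (Y u) (cov_deriv_along \<gamma> F v Z u))) (at u)"
proof -
  have Fu: "F u \<in> S"
    using W by auto
  have D: "((\<lambda>x. \<gamma> (F x) a b) has_derivative (\<lambda>v. dir_deriv (\<lambda>x. \<gamma> x a b) (F u) (dir_deriv F u v))) (at u)"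
    for a b
    using diff_chain_at[OF dir_deriv_has_derivative[OF F]
        dir_deriv_has_derivative[OF smooth_metric_onD(6)[OF \<gamma> Fu]]] by (simp add: o_def)
  have "((\<lambda>x. \<gamma> (F x) (Y x) (Z x)) has_derivative
    (\<lambda>v. dir_deriv (\<lambda>x. \<gamma> (F x) (Y u) (Z u)) u v + \<gamma> (F u) (dir_deriv Y u v) (Z u)
       + \<gamma> (F u) (Y u) (dir_deriv Z u v))) (at u)"
    using W smooth_metric_onD(3)[OF \<gamma>] D
    by (intro has_derivative_form_family[OF W(1,2)] dir_deriv_has_derivative Y Z)
      (auto intro: differentiableI[OF D])
  then show ?thesis
    by (rule has_derivative_eq_rhs)
      (auto simp: fun_eq_iff dir_deriv_eqI[OF D] christoffel_metric[OF \<gamma> Fu] cov_deriv_along_def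
        bilinear_simps[OF smooth_metric_onD(3)[OF \<gamma> Fu]])
qed

lemmas dir_deriv_metric_along = dir_deriv_eqI[OF has_derivative_metric_along]

lemma curvature_op_eq:
  assumes \<gamma>: "smooth_metric_on S \<gamma>" and u: "u \<in> S"
  shows "curvature_op \<gamma> u x y z =
      dir_deriv (\<lambda>u. christoffel \<gamma> u y z) u x + christoffel \<gamma> u x (christoffel \<gamma> u y z)
    - dir_deriv (\<lambda>u. christoffel \<gamma> u x z) u y - christoffel \<gamma> u y (christoffel \<gamma> u x z)"
proof -
  have "dir_deriv (\<lambda>u. christoffel \<gamma> u y z) u 0 = 0" for y
    using linear_0[OF linear_frechet_derivative[OF differentiable_christoffel[OF \<gamma> u]]] .
  moreover have "cov_deriv \<gamma> (\<lambda>_. y) (\<lambda>_. z) = (\<lambda>u. christoffel \<gamma> u y z)" for y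
    by (simp add: fun_eq_iff cov_deriv_def)
  ultimately show ?thesis
    by (simp add: curvature_op_def curvature_field_def cov_deriv_def lie_bracket_def
        bilinear_simps[OF bilinear_christoffel[OF \<gamma> u]])
qed

text \<open>Metric compatibility moves the derivative off the Christoffel map, which is given only implicitly,
  to the Koszul expression, which is explicit in the metric.\<close>

lemma curvature_form_eq:
  assumes \<gamma>: "smooth_metric_on S \<gamma>" and u: "u \<in> S"
  shows "curvature_form \<gamma> u x y z w =
      dir_deriv (\<lambda>u. koszul \<gamma> u y z w) u x - \<gamma> u (christoffel \<gamma> u y z) (christoffel \<gamma> u x w)
    - dir_deriv (\<lambda>u. koszul \<gamma> u x z w) u y + \<gamma> u (christoffel \<gamma> u x z) (christoffel \<gamma> u y w)"
proof -
  note S = smooth_metric_onD(1)[OF \<gamma>] u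
  have "dir_deriv (\<lambda>u. koszul \<gamma> u y z w) u x =
      \<gamma> u (dir_deriv (\<lambda>u. christoffel \<gamma> u y z) u x + christoffel \<gamma> u x (christoffel \<gamma> u y z)) w
      + \<gamma> u (christoffel \<gamma> u y z) (christoffel \<gamma> u x w)" for x y
  proof -
    have "dir_deriv (\<lambda>u. koszul \<gamma> u y z w) u x = dir_deriv (\<lambda>u. \<gamma> u (christoffel \<gamma> u y z) w) u x"
      by (rule dir_deriv_cong_open[OF S]) (simp add: christoffel_koszul[OF \<gamma>])
    also have "\<dots> = \<gamma> u (cov_deriv_along \<gamma> (\<lambda>x. x) x (\<lambda>u. christoffel \<gamma> u y z) u) w
        + \<gamma> u (christoffel \<gamma> u y z) (cov_deriv_along \<gamma> (\<lambda>x. x) x (\<lambda>u. w) u)"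
      using S by (intro dir_deriv_metric_along[OF \<gamma>, of S] differentiable_christoffel[OF \<gamma>]) auto
    finally show ?thesis
      by (simp add: cov_deriv_along_def)
  qed
  then show ?thesis
    unfolding curvature_form_def curvature_op_eq[OF \<gamma> u]
    by (simp add: bilinear_simps[OF smooth_metric_onD(3)[OF \<gamma> u]])
qed

section \<open>Algebraic curvature tensors\<close>

definition curvature_like :: "'v::real_vector form4 \<Rightarrow> bool" where
  "curvature_like T \<longleftrightarrow>
     (\<forall>x y z. linear (T x y z)) \<and>
     (\<forall>x y z w. T y x z w = - T x y z w) \<and> (\<forall>x y z w. T x y w z = - T x y z w) \<and>
     (\<forall>x y z w. T x y z w + T y z x w + T z x y w = 0)"

lemma curvature_likeD:
  assumes "curvature_like T"
  shows "linear (T x y z)" "T y x z w = - T x y z w" "T x y w z = - T x y z w"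
    "T x y z w + T y z x w + T z x y w = 0"
  using assms unfolding curvature_like_def by blast+

text \<open>The sum of the Bianchi identities for \<open>(x, y, z)\<close> and \<open>(y, z, w)\<close> minus the sum of those for
  \<open>(z, w, x)\<close> and \<open>(w, x, y)\<close> is \<open>2 (T x y z w - T z w x y)\<close>.\<close>

lemma curvature_like_pair_symmetric:
  assumes "curvature_like T"
  shows "T x y z w = T z w x y"
proof -
  note a = curvature_likeD(2-)[OF assms]
  show ?thesis
    using a(3)[of x y z w] a(3)[of y z w x] a(3)[of z w x y] a(3)[of w x y z]
      a(2)[of y z x w] a(2)[of z w x y] a(1)[of y w z x] a(1)[of x w z y] a(2)[of x w y z]
      a(1)[of z x w y] a(2)[of z x y w] a(1)[of x w y z] a(2)[of x y z w] a(2)[of y w z x]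
    by linarith
qed

text \<open>Polarization in the first and last, then in the middle arguments makes \<open>T\<close> alternating in all
  adjacent pairs, and the Bianchi identity leaves only \<open>3 T = 0\<close>.\<close>

lemma curvature_like_zeroI:
  assumes T: "curvature_like T" and sect: "\<And>x y. T x y y x = 0"
  shows "T x y z w = 0"
proof -
  note a = curvature_likeD(2-)[OF T]
  have add4: "T x y z (v + w) = T x y z v + T x y z w" for x y z v w
    using linear_add[OF curvature_likeD(1)[OF T]] .
  have add3: "T x y (v + w) z = T x y v z + T x y w z" for x y z v w
    using add4[of x y z v w] a(2)[of x y z "v + w"] a(2)[of x y z v] a(2)[of x y z w] by simp
  note pair = curvature_like_pair_symmetric[OF T]
  have add1: "T (v + w) y z x = T v y z x + T w y z x" for x y z v w
    using pair[of "v + w" y z x] pair[of v y z x] pair[of w y z x] add3[of z x v w y] by simp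
  have add2: "T y (v + w) z x = T y v z x + T y w z x" for x y z v w
    using pair[of y "v + w" z x] pair[of y v z x] pair[of y w z x] add4[of z x y v w] by simp
  have mid: "T x y y w = 0" for x y w
  proof -
    have "T (x + w) y y (x + w) = T x y y x + T x y y w + T w y y x + T w y y w"
      by (simp add: add1 add4)
    moreover have "T w y y x = T x y y w"
      using pair[of w y y x] a(2)[of x y y w] a(1)[of x y w y] by simp
    ultimately show ?thesis
      using sect[of "x + w" y] sect[of x y] sect[of w y] by simp
  qed
  have alt: "T x y z w = - T x z y w" for x y z w
    using add2[of x y z "y + z" w] add3[of x y y z w] add3[of x z y z w]
      mid[of x "y + z" w] mid[of x y w] mid[of x z w] by linarith
  show ?thesis
    using a(3)[of x y z w] alt[of x y z w] alt[of y z x w] a(1)[of x y z w] a(1)[of x z y w] by linarith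
qed

lemma curvature_like_diff:
  assumes T: "curvature_like T" and T': "curvature_like T'"
  shows "curvature_like (\<lambda>x y z w. T x y z w - k * T' x y z w)"
  unfolding curvature_like_def
proof (intro conjI allI)
  fix x y z w
  show "linear (\<lambda>w. T x y z w - k * T' x y z w)"
    using linear_compose_sub[OF curvature_likeD(1)[OF T]
        linear_compose_scale_right[OF curvature_likeD(1)[OF T'], of k]] by simp
  show "T y x z w - k * T' y x z w = - (T x y z w - k * T' x y z w)"
    using curvature_likeD(2)[OF T, of x y z w] curvature_likeD(2)[OF T', of x y z w] by simp
  show "T x y w z - k * T' x y w z = - (T x y z w - k * T' x y z w)"
    using curvature_likeD(3)[OF T, of x y z w] curvature_likeD(3)[OF T', of x y z w] by simp
  have "T x y z w - k * T' x y z w + (T y z x w - k * T' y z x w) + (T z x y w - k * T' z x y w)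
      = (T x y z w + T y z x w + T z x y w) - k * (T' x y z w + T' y z x w + T' z x y w)"
    by (simp add: algebra_simps)
  then show "T x y z w - k * T' x y z w + (T y z x w - k * T' y z x w) + (T z x y w - k * T' z x y w) = 0"
    by (simp add: curvature_likeD(4)[OF T] curvature_likeD(4)[OF T'])
qed

lemma curvature_like_KN:
  assumes "nondegenerate_symmetric b"
  shows "curvature_like (KN b b)"
  unfolding curvature_like_def KN_def
proof (intro conjI allI)
  fix x y z w
  note sym = nondegenerate_symmetricD(2)[OF assms]
  show "linear (\<lambda>w. b x w * b y z + b y z * b x w - b x z * b y w - b y w * b x z)"
    by (rule linearI) (simp_all add: bilinear_simps[OF nondegenerate_symmetricD(1)[OF assms]] algebra_simps)
  show "b x w * b y z + b y z * b x w - b x z * b y w - b y w * b x z +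
       (b y w * b z x + b z x * b y w - b y x * b z w - b z w * b y x) +
       (b z w * b x y + b x y * b z w - b z y * b x w - b x w * b z y) = 0"
    using sym[of z x] sym[of y x] sym[of z y] by simp
qed simp_all

text \<open>The Bianchi identity comes from the symmetry of the Christoffel map. For the antisymmetry in the last
  two arguments, the Koszul expressions for \<open>(y, z, w)\<close> and \<open>(y, w, z)\<close> add up to the derivative of
  \<open>\<gamma> z w\<close> in direction \<open>y\<close>, so that second derivatives of the metric have to commute.\<close>

lemma curvature_like_curvature_form:
  assumes \<gamma>: "smooth_metric_on S \<gamma>" and u: "u \<in> S"
  shows "curvature_like (curvature_form \<gamma> u)"
  unfolding curvature_like_def
proof (intro conjI allI)
  fix x y z w
  note bil = smooth_metric_onD(3)[OF \<gamma> u] and sym = smooth_metric_onD(4)[OF \<gamma> u]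
  note csym = christoffel_symmetric[OF \<gamma>]
  note S = smooth_metric_onD(1)[OF \<gamma>] u
  show "linear (curvature_form \<gamma> u x y z)"
    unfolding curvature_form_def using bil by (simp add: bilinear_def)
  show "curvature_form \<gamma> u y x z w = - curvature_form \<gamma> u x y z w"
    by (simp add: curvature_form_eq[OF \<gamma> u])
  have dsym: "dir_deriv (\<lambda>u. christoffel \<gamma> u x y) u z = dir_deriv (\<lambda>u. christoffel \<gamma> u y x) u z" for x y z
    using csym by (intro dir_deriv_cong_open[OF S])
  have "curvature_op \<gamma> u x y z + curvature_op \<gamma> u y z x + curvature_op \<gamma> u z x y = 0"
    using csym[OF u, of x y] csym[OF u, of y z] csym[OF u, of x z] dsym[of x y z] dsym[of y z x] dsym[of x z y]
    by (simp add: curvature_op_eq[OF \<gamma> u])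
  then show "curvature_form \<gamma> u x y z w + curvature_form \<gamma> u y z x w + curvature_form \<gamma> u z x y w = 0"
    unfolding curvature_form_def using bilinear_lzero[OF bil]
    by (simp flip: bilinear_ladd[OF bil])
  have dk: "dir_deriv (\<lambda>u. koszul \<gamma> u y w z) u x
      = dir_deriv (\<lambda>u. dir_deriv (\<lambda>u. \<gamma> u z w) u y) u x - dir_deriv (\<lambda>u. koszul \<gamma> u y z w) u x" for x y
  proof -
    have "koszul \<gamma> v y w z = dir_deriv (\<lambda>u. \<gamma> u z w) v y - koszul \<gamma> v y z w" if "v \<in> S" for v
      using metric_deriv_symmetric[OF \<gamma> that, of z w y] by (simp add: koszul_def field_simps)
    then have "dir_deriv (\<lambda>u. koszul \<gamma> u y w z) u x
        = dir_deriv (\<lambda>u. dir_deriv (\<lambda>u. \<gamma> u z w) u y - koszul \<gamma> u y z w) u x"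
      by (intro dir_deriv_cong_open[OF S]) auto
    also have "\<dots> = dir_deriv (\<lambda>u. dir_deriv (\<lambda>u. \<gamma> u z w) u y) u x - dir_deriv (\<lambda>u. koszul \<gamma> u y z w) u x"
      by (intro dir_deriv_eqI has_derivative_diff dir_deriv_has_derivative differentiable_koszul[OF \<gamma> u]
          smooth_on_differentiable[OF smooth_on_dir_deriv[OF smooth_metric_onD(5)[OF \<gamma>]] u])
    finally show ?thesis .
  qed
  show "curvature_form \<gamma> u x y w z = - curvature_form \<gamma> u x y z w"
    using second_deriv_symmetric[OF S(1) smooth_metric_onD(5)[OF \<gamma>] u, of z w y x]
      sym[of "christoffel \<gamma> u y w" "christoffel \<gamma> u x z"] sym[of "christoffel \<gamma> u x w" "christoffel \<gamma> u y z"]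
    by (simp add: curvature_form_eq[OF \<gamma> u] dk)
qed

section \<open>Constant curvature\<close>

definition positive_form :: "'v::real_vector form2 \<Rightarrow> bool" where
  "positive_form b \<longleftrightarrow> bilinear b \<and> (\<forall>v w. b v w = b w v) \<and> (\<forall>v. v \<noteq> 0 \<longrightarrow> 0 < b v v)"

lemma positive_formD:
  assumes "positive_form b"
  shows "bilinear b" "b v w = b w v" "v \<noteq> 0 \<Longrightarrow> 0 < b v v" "b v v = 0 \<longleftrightarrow> v = 0"
proof -
  show b: "bilinear b" "b v w = b w v" "v \<noteq> 0 \<Longrightarrow> 0 < b v v"
    using assms by (simp_all add: positive_form_def)
  show "b v v = 0 \<longleftrightarrow> v = 0"
    using b(3) bilinear_lzero[OF b(1)] by fastforce
qed

lemma positive_form_nondegenerate: "positive_form b \<Longrightarrow> nondegenerate_symmetric b"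
  unfolding nondegenerate_symmetric_def using positive_formD by metis

text \<open>The equality case of the Cauchy-Schwarz inequality: the component of \<open>v\<close> orthogonal to \<open>w\<close> has
  length zero.\<close>

lemma positive_form_equality_case:
  assumes b: "positive_form b" and eq: "b v v * b w w - (b v w)\<^sup>2 = 0" and "w \<noteq> 0"
  shows "\<exists>t. v = t *\<^sub>R w"
proof -
  note bil = positive_formD(1)[OF b]
  define t where "t = b v w / b w w"
  have nz: "b w w \<noteq> 0"
    using positive_formD(4)[OF b] \<open>w \<noteq> 0\<close> by auto
  have "b (v - t *\<^sub>R w) (v - t *\<^sub>R w) = b v v - 2 * t * b v w + t * t * b w w"
    using positive_formD(2)[OF b, of w v] by (simp add: bilinear_simps[OF bil] algebra_simps)
  also have "\<dots> = (b v v * b w w - (b v w)\<^sup>2) / b w w"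
    using nz by (simp add: t_def field_simps power2_eq_square)
  finally have "v - t *\<^sub>R w = 0"
    using eq positive_formD(4)[OF b] by simp
  then show ?thesis
    by auto
qed

text \<open>The difference of the two sides is an algebraic curvature tensor that vanishes on all planes. On
  dependent pairs, where the assumption is silent, both sides vanish by antisymmetry.\<close>

lemma constant_sectional_curvature:
  assumes b: "positive_form b" and T: "curvature_like T"
    and sect: "\<And>v w. b v v * b w w - (b v w)\<^sup>2 \<noteq> 0 \<Longrightarrow> T v w w v / (b v v * b w w - (b v w)\<^sup>2) = k"
  shows "T x y z w = k / 2 * KN b b x y z w"
proof -
  have "T v w w v - k / 2 * KN b b v w w v = 0" for v w
  proof (cases "b v v * b w w - (b v w)\<^sup>2 = 0")
    case True
    have KN: "KN b b v w w v = 2 * (b v v * b w w - (b v w)\<^sup>2)"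
      using positive_formD(2)[OF b, of w v] by (simp add: KN_def power2_eq_square)
    have "T v w w v = 0"
    proof (cases "w = 0")
      case True
      then show ?thesis
        using curvature_likeD(3)[OF T, of v 0 v 0] linear_0[OF curvature_likeD(1)[OF T]] by simp
    next
      case False
      then obtain t where "v = t *\<^sub>R w"
        using positive_form_equality_case[OF b True] by blast
      moreover have "T v w w w = 0"
        using curvature_likeD(3)[OF T, of v w w w] by simp
      ultimately show ?thesis
        using linear_cmul[OF curvature_likeD(1)[OF T], of v w w t w] by simp
    qed
    then show ?thesis
      using KN True by simp
  next
    case False
    have "KN b b v w w v = 2 * (b v v * b w w - (b v w)\<^sup>2)"
      using positive_formD(2)[OF b, of w v] by (simp add: KN_def power2_eq_square)
    moreover have "T v w w v = k * (b v v * b w w - (b v w)\<^sup>2)"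
      using sect[OF False] unfolding nonzero_divide_eq_eq[OF False] .
    ultimately show ?thesis
      by simp
  qed
  from curvature_like_zeroI[OF curvature_like_diff[OF T
        curvature_like_KN[OF positive_form_nondegenerate[OF b]]] this]
  show ?thesis
    by simp
qed

section \<open>Conformal change of the metric\<close>

lemma smooth_metric_on_conformal:
  assumes \<gamma>: "smooth_metric_on S \<gamma>" and \<sigma>: "smooth_on S \<sigma>"
  shows "smooth_metric_on S (\<lambda>u v w. exp (2 * \<sigma> u) * \<gamma> u v w)"
  unfolding smooth_metric_on_def
proof (intro conjI allI ballI)
  note S = smooth_metric_onD(1)[OF \<gamma>]
  show "open S"
    by (rule S)
  fix v w
  show "smooth_on S (\<lambda>u. exp (2 * \<sigma> u) * \<gamma> u v w)"
    by (intro smooth_on_mult smooth_on_exp smooth_on_const S \<sigma> smooth_metric_onD(5)[OF \<gamma>])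
next
  fix u assume u: "u \<in> S"
  note bil = smooth_metric_onD(3)[OF \<gamma> u]
  have "bilinear (\<lambda>v w. exp (2 * \<sigma> u) * \<gamma> u v w)"
    unfolding bilinear_def
    by (intro conjI allI linearI) (simp_all add: bilinear_simps[OF bil] algebra_simps)
  then show "nondegenerate_symmetric (\<lambda>v w. exp (2 * \<sigma> u) * \<gamma> u v w)"
    using smooth_metric_onD(2)[OF \<gamma> u] by (simp add: nondegenerate_symmetric_def)
qed

lemma koszul_conformal:
  assumes \<gamma>: "smooth_metric_on S \<gamma>" and \<sigma>: "smooth_on S \<sigma>" and u: "u \<in> S"
  shows "koszul (\<lambda>u v w. exp (2 * \<sigma> u) * \<gamma> u v w) u y z w = exp (2 * \<sigma> u) *
    (koszul \<gamma> u y z w + dir_deriv \<sigma> u y * \<gamma> u z w + dir_deriv \<sigma> u z * \<gamma> u y w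
      - dir_deriv \<sigma> u w * \<gamma> u y z)"
proof -
  have "((\<lambda>u. exp (2 * \<sigma> u) * \<gamma> u v w) has_derivative (\<lambda>x. exp (2 * \<sigma> u) *
      (dir_deriv (\<lambda>u. \<gamma> u v w) u x + 2 * dir_deriv \<sigma> u x * \<gamma> u v w))) (at u)" for v w
    by (rule derivative_eq_intros refl smooth_on_has_derivative[OF \<sigma> u]
        dir_deriv_has_derivative[OF smooth_metric_onD(6)[OF \<gamma> u]])+ (simp add: fun_eq_iff algebra_simps)
  note D = dir_deriv_eqI[OF this]
  show ?thesis
    unfolding koszul_def D by (simp add: field_simps)
qed

text \<open>The form in question is \<open>Hess \<sigma> - d\<sigma> \<otimes> d\<sigma> + \<bar>d\<sigma>\<bar>\<^sup>2 \<gamma> / 2\<close>. The new Christoffel map differs from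
  the old one by \<open>T\<close> below, and with its values all terms of the curvature formula become polynomials
  in the products of the given vectors, the derivatives of \<open>\<sigma>\<close> and the Koszul expressions.\<close>

lemma curvature_form_conformal:
  assumes \<gamma>: "smooth_metric_on S \<gamma>" and \<sigma>: "smooth_on S \<sigma>" and u: "u \<in> S"
  shows "\<exists>A. \<forall>x y z w. curvature_form (\<lambda>u v w. exp (2 * \<sigma> u) * \<gamma> u v w) u x y z w
    = exp (2 * \<sigma> u) * (curvature_form \<gamma> u x y z w - KN (\<gamma> u) A x y z w)"
proof -
  define \<gamma>' where "\<gamma>' = (\<lambda>u v w. exp (2 * \<sigma> u) * \<gamma> u v w)"
  note S = smooth_metric_onD(1)[OF \<gamma>] u
  note \<gamma>' = smooth_metric_on_conformal[OF \<gamma> \<sigma>, folded \<gamma>'_def]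
  note K' = koszul_conformal[OF \<gamma> \<sigma>, folded \<gamma>'_def]
  note bil = smooth_metric_onD(3)[OF \<gamma> u] and sym = smooth_metric_onD(4)[OF \<gamma> u]
  define e where "e = exp (2 * \<sigma> u)"
  define s where "s = dir_deriv \<sigma> u"
  define h where "h = (\<lambda>y x. dir_deriv (\<lambda>u. dir_deriv \<sigma> u y) u x)"
  define K where "K = koszul \<gamma> u"
  define \<Gamma> where "\<Gamma> = christoffel \<gamma> u"
  have \<Gamma>K: "\<gamma> u (\<Gamma> y z) w = K y z w" for y z w
    unfolding \<Gamma>_def K_def by (rule christoffel_koszul[OF \<gamma> u])
  have K\<Gamma>: "\<gamma> u w (\<Gamma> y z) = K y z w" for y z w
    using \<Gamma>K sym by metis
  have s: "linear s"
    unfolding s_def by (rule linear_frechet_derivative[OF smooth_on_differentiable[OF \<sigma> u]])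
  \<comment> \<open>\<open>N\<close> is the gradient of \<open>\<sigma>\<close>.\<close>
  then obtain N where N: "\<And>w. \<gamma> u N w = s w"
    using nondegenerate_represents[OF smooth_metric_onD(2)[OF \<gamma> u]] by blast
  then have N': "\<gamma> u w N = s w" for w
    using sym by metis
  define T where "T = (\<lambda>y z. s y *\<^sub>R z + s z *\<^sub>R y - \<gamma> u y z *\<^sub>R N)"
  have \<Gamma>': "christoffel \<gamma>' u y z = \<Gamma> y z + T y z" for y z
  proof (rule nondegenerate_eqI[OF smooth_metric_onD(2)[OF \<gamma>' u]])
    fix w
    show "\<gamma>' u (christoffel \<gamma>' u y z) w = \<gamma>' u (\<Gamma> y z + T y z) w"
      unfolding christoffel_koszul[OF \<gamma>' u] K'[OF u]
      by (simp add: bilinear_simps[OF bil] \<Gamma>K N T_def \<gamma>'_def flip: s_def K_def)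
  qed
  have dg: "dir_deriv (\<lambda>u. \<gamma> u v w) u x = K x v w + K x w v" for v w x
    unfolding christoffel_metric[OF \<gamma> u] \<Gamma>_def[symmetric] \<Gamma>K K\<Gamma> ..
  have dK': "dir_deriv (\<lambda>u. koszul \<gamma>' u y z w) u x = e *
     (2 * s x * (K y z w + s y * \<gamma> u z w + s z * \<gamma> u y w - s w * \<gamma> u y z)
      + (dir_deriv (\<lambda>u. koszul \<gamma> u y z w) u x
      + (h y x * \<gamma> u z w + s y * (K x z w + K x w z)) + (h z x * \<gamma> u y w + s z * (K x y w + K x w y))
      - (h w x * \<gamma> u y z + s w * (K x y z + K x z y))))" for x y z w
  proof -
    have g: "((\<lambda>u. \<gamma> u v w) has_derivative (\<lambda>x. K x v w + K x w v)) (at u)" for v w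
      using dir_deriv_has_derivative[OF smooth_metric_onD(6)[OF \<gamma> u, of v w]] dg[of v w] by simp
    have ds: "((\<lambda>u. dir_deriv \<sigma> u v) has_derivative h v) (at u)" for v
      unfolding h_def by (rule smooth_on_has_derivative[OF smooth_on_dir_deriv[OF \<sigma>] u])
    note derivs = smooth_on_has_derivative[OF \<sigma> u] ds g
      dir_deriv_has_derivative[OF differentiable_koszul[OF \<gamma> u]]
    have "((\<lambda>u. exp (2 * \<sigma> u) * (koszul \<gamma> u y z w + dir_deriv \<sigma> u y * \<gamma> u z w + dir_deriv \<sigma> u z * \<gamma> u y w
        - dir_deriv \<sigma> u w * \<gamma> u y z)) has_derivative (\<lambda>x. e *
     (2 * s x * (K y z w + s y * \<gamma> u z w + s z * \<gamma> u y w - s w * \<gamma> u y z)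
      + (dir_deriv (\<lambda>u. koszul \<gamma> u y z w) u x
      + (h y x * \<gamma> u z w + s y * (K x z w + K x w z)) + (h z x * \<gamma> u y w + s z * (K x y w + K x w y))
      - (h w x * \<gamma> u y z + s w * (K x y z + K x z y)))))) (at u)"
      by (rule derivative_eq_intros refl derivs)+
        (simp add: fun_eq_iff e_def s_def K_def algebra_simps)
    from dir_deriv_eqI[OF has_derivative_transform_within_open[OF this S K'[symmetric]]]
    show ?thesis .
  qed
  have hsym: "h y x = h x y" for x y
    unfolding h_def by (rule second_deriv_symmetric[OF S(1) \<sigma> u])
  define A where "A = (\<lambda>y z. h y z - K y z N - s y * s z + s N / 2 * \<gamma> u y z)"
  have "curvature_form \<gamma>' u x y z w = e * (curvature_form \<gamma> u x y z w - KN (\<gamma> u) A x y z w)" for x y z w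
  proof -
    have Ksym: "K a b c = K b a c" for a b c
      using christoffel_symmetric[OF \<gamma> u, of a b] by (simp flip: \<Gamma>K \<Gamma>_def)
    have inner': "\<gamma>' u (christoffel \<gamma>' u a b) (christoffel \<gamma>' u c d) =
      e * (\<gamma> u (\<Gamma> a b) (\<Gamma> c d) + \<gamma> u (\<Gamma> a b) (T c d) + \<gamma> u (T a b) (\<Gamma> c d) + \<gamma> u (T a b) (T c d))" for a b c d
      unfolding \<Gamma>' by (simp add: \<gamma>'_def e_def bilinear_simps[OF bil] algebra_simps)
    have \<Gamma>T: "\<gamma> u (\<Gamma> a b) (T c d) = s c * K a b d + s d * K a b c - \<gamma> u c d * K a b N" for a b c d
      unfolding T_def by (simp add: bilinear_simps[OF bil] \<Gamma>K)
    have T\<Gamma>: "\<gamma> u (T c d) (\<Gamma> a b) = s c * K a b d + s d * K a b c - \<gamma> u c d * K a b N" for a b c d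
      using \<Gamma>T sym by metis
    have TT: "\<gamma> u (T a b) (T c d) = s a * s c * \<gamma> u b d + s a * s d * \<gamma> u b c - s a * s b * \<gamma> u c d
      + s b * s c * \<gamma> u a d + s b * s d * \<gamma> u a c - s b * s a * \<gamma> u c d
      - \<gamma> u a b * s c * s d - \<gamma> u a b * s d * s c + \<gamma> u a b * \<gamma> u c d * s N" for a b c d
      unfolding T_def by (simp add: bilinear_simps[OF bil] linear_add[OF s] linear_diff[OF s]
          linear_cmul[OF s] N N' algebra_simps)
    show ?thesis
      unfolding curvature_form_eq[OF \<gamma>' u] curvature_form_eq[OF \<gamma> u] dK' inner' \<Gamma>T T\<Gamma> TT
        KN_def A_def \<Gamma>_def[symmetric]
      using hsym[of x y] hsym[of z x] hsym[of z y] hsym[of w x] hsym[of w y]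
        sym[of y x] sym[of z x] sym[of z y] sym[of w x] sym[of w y] sym[of w z]
        Ksym[of y x] Ksym[of z x] Ksym[of z y] Ksym[of w x] Ksym[of w y] Ksym[of w z]
      by (simp add: field_simps)
  qed
  then show ?thesis
    unfolding \<gamma>'_def e_def by blast
qed

section \<open>The Gauss equation\<close>

text \<open>The curvature of the ambient space is the commutator of covariant derivatives of the
  coordinate fields along the map; the third derivatives of the map cancel.\<close>

lemma
  assumes G: "smooth_metric_on W G" and U: "open U" "u \<in> U" and F: "smooth_on U F" "F ` U \<subseteq> W"
  defines "B \<equiv> \<lambda>y z. cov_deriv_along G F y (\<lambda>u. dir_deriv F u z)"
  shows second_cov_deriv_symmetric: "B y z u = B z y u"
    and second_cov_deriv_differentiable: "B y z differentiable (at u)"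
    and curvature_along_map: "cov_deriv_along G F x (B y z) u - cov_deriv_along G F y (B x z) u
      = curvature_op G (F u) (dir_deriv F u x) (dir_deriv F u y) (dir_deriv F u z)"
proof -
  have Fu: "F u \<in> W"
    using U F by auto
  note cbil = bilinear_christoffel[OF G Fu] and csym = christoffel_symmetric[OF G Fu]
  have B: "B y z = (\<lambda>v. dir_deriv (\<lambda>v. dir_deriv F v z) v y
      + christoffel G (F v) (dir_deriv F v y) (dir_deriv F v z))" for y z
    by (simp add: B_def cov_deriv_along_def fun_eq_iff)
  have schwarz: "dir_deriv (\<lambda>v. dir_deriv F v z) v y = dir_deriv (\<lambda>v. dir_deriv F v y) v z"
    if "v \<in> U" for y z v
    by (rule second_deriv_symmetric[OF U(1) F(1) that])
  show "B y z u = B z y u"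
    unfolding B using schwarz[OF U(2), of z y] csym by simp
  define L where "L = (\<lambda>a b x. dir_deriv (\<lambda>v. christoffel G v a b) (F u) x)"
  note dF = smooth_on_has_derivative[OF smooth_on_dir_deriv[OF F(1)] U(2)]
  have DL: "((\<lambda>v. christoffel G (F v) a b) has_derivative (\<lambda>x. L a b (dir_deriv F u x))) (at u)" for a b
    using diff_chain_at[OF smooth_on_has_derivative[OF F(1) U(2)]
        dir_deriv_has_derivative[OF differentiable_christoffel[OF G Fu]]] by (simp add: o_def L_def)
  have DB: "(B y z has_derivative (\<lambda>x. dir_deriv (\<lambda>v. dir_deriv (\<lambda>v. dir_deriv F v z) v y) u x
     + (L (dir_deriv F u y) (dir_deriv F u z) (dir_deriv F u x)
     + christoffel G (F u) (dir_deriv (\<lambda>v. dir_deriv F v y) u x) (dir_deriv F u z)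
     + christoffel G (F u) (dir_deriv F u y) (dir_deriv (\<lambda>v. dir_deriv F v z) u x)))) (at u)" for y z
  proof -
    have "((\<lambda>v. christoffel G (F v) (dir_deriv F v y) (dir_deriv F v z)) has_derivative
      (\<lambda>x. dir_deriv (\<lambda>v. christoffel G (F v) (dir_deriv F u y) (dir_deriv F u z)) u x
       + christoffel G (F u) (dir_deriv (\<lambda>v. dir_deriv F v y) u x) (dir_deriv F u z)
       + christoffel G (F u) (dir_deriv F u y) (dir_deriv (\<lambda>v. dir_deriv F v z) u x))) (at u)"
      using F(2) by (intro has_derivative_form_family[OF U] bilinear_christoffel[OF G] dF differentiableI[OF DL]) auto
    from has_derivative_add[OF smooth_on_has_derivative[OF smooth_on_dir_deriv[OF smooth_on_dir_deriv[OF F(1)]] U(2)] this]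
    show ?thesis
      unfolding B dir_deriv_eqI[OF DL] .
  qed
  show "B y z differentiable (at u)"
    by (rule differentiableI[OF DB])
  have third: "dir_deriv (\<lambda>v. dir_deriv (\<lambda>v. dir_deriv F v z) v y) u x
      = dir_deriv (\<lambda>v. dir_deriv (\<lambda>v. dir_deriv F v z) v x) u y"
    by (rule second_deriv_symmetric[OF U(1) smooth_on_dir_deriv[OF F(1)] U(2)])
  show "cov_deriv_along G F x (B y z) u - cov_deriv_along G F y (B x z) u
      = curvature_op G (F u) (dir_deriv F u x) (dir_deriv F u y) (dir_deriv F u z)"
    unfolding curvature_op_eq[OF G Fu] cov_deriv_along_def dir_deriv_eqI[OF DB]
    using third schwarz[OF U(2), of y x]
    by (simp add: B L_def bilinear_simps[OF cbil] algebra_simps)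
qed

text \<open>The tangential part of the second covariant derivative \<open>B\<close> of \<open>F\<close> is the image of the intrinsic
  Christoffel map, so \<open>G (B y z) (dF w)\<close> is the Koszul expression of \<open>g\<close>. Differentiating it by the
  ambient product rule and antisymmetrizing gives the ambient curvature and products
  \<open>G (B y z) (B x w)\<close>, the curvature formula for \<open>g\<close> the same products of the tangential parts; the
  normal parts \<open>II\<close> remain. They occur only at the point itself, so a normal vector suffices and no
  normal field has to be differentiated.\<close>

lemma
  assumes g: "smooth_metric_on U g" and G: "smooth_metric_on W G" and u: "u \<in> U"
    and F: "smooth_on U F" "F ` U \<subseteq> W"
    and iso: "\<And>u v w. u \<in> U \<Longrightarrow> g u v w = G (F u) (dir_deriv F u v) (dir_deriv F u w)"
  defines "II \<equiv> \<lambda>y z. cov_deriv_along G F y (\<lambda>u. dir_deriv F u z) u - dir_deriv F u (christoffel g u y z)"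
  shows gauss_formula_normal: "G (F u) (II y z) (dir_deriv F u w) = 0"
    and gauss_equation: "curvature_form g u x y z w =
      curvature_form G (F u) (dir_deriv F u x) (dir_deriv F u y) (dir_deriv F u z) (dir_deriv F u w)
      + G (F u) (II y z) (II x w) - G (F u) (II x z) (II y w)"
proof -
  note U = smooth_metric_onD(1)[OF g]
  have Fu: "F v \<in> W" if "v \<in> U" for v
    using F that by auto
  define B where "B = (\<lambda>y z. cov_deriv_along G F y (\<lambda>u. dir_deriv F u z))"
  have fold: "cov_deriv_along G F y (\<lambda>u. dir_deriv F u z) = B y z" for y z
    by (simp add: B_def)
  note Bsym = second_cov_deriv_symmetric[OF G U _ F, unfolded fold]
    and Bdiff = second_cov_deriv_differentiable[OF G U _ F, unfolded fold]
    and Bcurv = curvature_along_map[OF G U u F, unfolded fold]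
  note Gbil = smooth_metric_onD(3)[OF G Fu] and Gsym = smooth_metric_onD(4)[OF G Fu]
  have dFd: "(\<lambda>u. dir_deriv F u z) differentiable (at v)" if "v \<in> U" for z v
    by (rule smooth_on_differentiable[OF smooth_on_dir_deriv[OF F(1)] that])
  note along = dir_deriv_metric_along[OF G U _ F(2) smooth_on_differentiable[OF F(1)]]
  have dg: "dir_deriv (\<lambda>u. g u z w) v y = G (F v) (B y z v) (dir_deriv F v w) + G (F v) (dir_deriv F v z) (B y w v)"
    if v: "v \<in> U" for y z w v
  proof -
    have "dir_deriv (\<lambda>u. g u z w) v y = dir_deriv (\<lambda>u. G (F u) (dir_deriv F u z) (dir_deriv F u w)) v y"
      by (rule dir_deriv_cong_open[OF U v iso])
    also have "\<dots> = G (F v) (B y z v) (dir_deriv F v w) + G (F v) (dir_deriv F v z) (B y w v)"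
      using along[OF v v dFd[OF v] dFd[OF v]] by (simp add: fold)
    finally show ?thesis .
  qed
  have tangential: "koszul g v y z w = G (F v) (B y z v) (dir_deriv F v w)" if v: "v \<in> U" for v y z w
    unfolding koszul_def dg[OF v]
    using Bsym[OF v, of y z] Bsym[OF v, of y w] Bsym[OF v, of z w] Gsym[OF v]
    by (simp add: field_simps)
  have II: "II y z = B y z u - dir_deriv F u (christoffel g u y z)" for y z
    by (simp add: II_def B_def)
  have GB: "G (F u) (B y z u) (dir_deriv F u w) = G (F u) (dir_deriv F u (christoffel g u y z)) (dir_deriv F u w)" for y z w
    using tangential[OF u, of y z w] christoffel_koszul[OF g u, of y z w] iso[OF u] by simp
  have BG: "G (F u) (dir_deriv F u w) (B y z u) = G (F u) (dir_deriv F u w) (dir_deriv F u (christoffel g u y z))" for y z w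
    using GB[of y z w] Gsym[OF u] by metis
  show "G (F u) (II y z) (dir_deriv F u w) = 0"
    unfolding II using GB by (simp add: bilinear_simps[OF Gbil[OF u]])
  have dk: "dir_deriv (\<lambda>u. koszul g u y z w) u x =
     G (F u) (cov_deriv_along G F x (B y z) u) (dir_deriv F u w) + G (F u) (B y z u) (B x w u)" for x y
  proof -
    have "dir_deriv (\<lambda>u. koszul g u y z w) u x = dir_deriv (\<lambda>v. G (F v) (B y z v) (dir_deriv F v w)) u x"
      by (rule dir_deriv_cong_open[OF U u tangential])
    also have "\<dots> = G (F u) (cov_deriv_along G F x (B y z) u) (dir_deriv F u w) + G (F u) (B y z u) (B x w u)"
      using along[OF u u Bdiff[OF u] dFd[OF u]] by (simp add: fold)
    finally show ?thesis .
  qed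
  have IIII: "G (F u) (II a b) (II c d) = G (F u) (B a b u) (B c d u)
      - g u (christoffel g u a b) (christoffel g u c d)" for a b c d
    unfolding II iso[OF u] by (simp add: bilinear_simps[OF Gbil[OF u]] GB BG)
  have "curvature_form G (F u) (dir_deriv F u x) (dir_deriv F u y) (dir_deriv F u z) (dir_deriv F u w)
    = G (F u) (cov_deriv_along G F x (B y z) u) (dir_deriv F u w)
      - G (F u) (cov_deriv_along G F y (B x z) u) (dir_deriv F u w)"
    unfolding curvature_form_def Bcurv[symmetric] by (simp add: bilinear_simps[OF Gbil[OF u]])
  then show "curvature_form g u x y z w =
      curvature_form G (F u) (dir_deriv F u x) (dir_deriv F u y) (dir_deriv F u z) (dir_deriv F u w)
      + G (F u) (II y z) (II x w) - G (F u) (II x z) (II y w)"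
    unfolding curvature_form_eq[OF g u] dk IIII by simp
qed

section \<open>Traces and ranks\<close>

lemma trace_matrix: "trace (matrix L) = (\<Sum>i\<in>UNIV. L (axis i 1) $ i)"
  for L :: "real ^ 'n::finite \<Rightarrow> real ^ 'n"
  by (simp add: trace_def matrix_def)

lemma trace_rank_one:
  fixes \<phi> :: "real ^ 'n::finite \<Rightarrow> real"
  assumes "linear \<phi>"
  shows "trace (matrix (\<lambda>z. \<phi> z *\<^sub>R a)) = \<phi> a"
  using linear_axis_sum[OF assms, of a] by (simp add: trace_matrix mult.commute)

text \<open>With the coordinate functionals \<open>\<phi> v\<close> of the basis, \<open>L\<close> is the sum of the rank one maps
  \<open>z \<mapsto> \<phi> v z \<mu> v v\<close>, whose traces are \<open>\<mu> v\<close>.\<close>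

lemma trace_eigenbasis:
  fixes L :: "real ^ 'n::finite \<Rightarrow> real ^ 'n"
  assumes "linear L" and B: "independent B" "span B = UNIV" and eig: "\<And>v. v \<in> B \<Longrightarrow> L v = \<mu> v *\<^sub>R v"
  shows "trace (matrix L) = (\<Sum>v\<in>B. \<mu> v)"
proof -
  have fin: "finite B"
    using B(1) by (rule finiteI_independent)
  define \<phi> where "\<phi> = (\<lambda>v w. representation B w v)"
  have \<phi>: "linear (\<phi> v)" for v
    unfolding \<phi>_def using B by (intro linearI) (simp_all add: representation_add representation_scale)
  have L: "L z = (\<Sum>v\<in>B. \<phi> v z *\<^sub>R \<mu> v *\<^sub>R v)" for z
  proof -
    have "L z = L (\<Sum>v\<in>B. \<phi> v z *\<^sub>R v)"
      using sum_representation_eq[OF B(1), of z B] B(2) fin by (simp add: \<phi>_def)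
    also have "\<dots> = (\<Sum>v\<in>B. \<phi> v z *\<^sub>R \<mu> v *\<^sub>R v)"
      by (simp add: linear_sum[OF assms(1)] linear_cmul[OF assms(1)] eig cong: sum.cong)
    finally show ?thesis .
  qed
  have "trace (matrix L) = (\<Sum>v\<in>B. \<Sum>i\<in>UNIV. \<phi> v (axis i 1) * (\<mu> v * v $ i))"
    unfolding trace_matrix L by (simp add: sum.swap[of _ B] mult.assoc)
  also have "\<dots> = (\<Sum>v\<in>B. \<mu> v * trace (matrix (\<lambda>z. \<phi> v z *\<^sub>R v)))"
    by (simp add: trace_matrix sum_distrib_left ac_simps)
  also have "\<dots> = (\<Sum>v\<in>B. \<mu> v)"
  proof (rule sum.cong)
    fix v assume "v \<in> B"
    then have "\<phi> v v = 1"
      using B(1) by (simp add: \<phi>_def representation_basis)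
    then show "\<mu> v * trace (matrix (\<lambda>z. \<phi> v z *\<^sub>R v)) = \<mu> v"
      by (simp add: trace_rank_one[OF \<phi>])
  qed simp
  finally show ?thesis .
qed

text \<open>Two vectors on which \<open>B\<close> is diagonal with nonzero entries have independent images under the
  matrix of \<open>B\<close>.\<close>

lemma form_rank_ge_2:
  fixes B :: "(real ^ 'n::finite) form2"
  assumes B: "bilinear B" and "B v v \<noteq> 0" "B w w \<noteq> 0" "B v w = 0" "B w v = 0"
  shows "2 \<le> form_rank B"
proof -
  define M where "M = (\<chi> i j. B (axis i 1) (axis j 1) :: real ^ 'n ^ 'n)"
  have lin: "linear (B x)" "linear (\<lambda>x. B x y)" for x y
    using B by (auto simp: bilinear_def)
  have "(M *v y) $ i = B (axis i 1) y" for y i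
    using linear_axis_sum[OF lin(1), of "axis i 1" y]
    by (simp add: M_def matrix_vector_mult_def mult.commute)
  then have M: "x \<bullet> (M *v y) = B x y" for x y
    using linear_axis_sum[OF lin(2), of x y] by (simp add: inner_vec_def)
  have "independent {M *v v, M *v w} \<and> M *v v \<noteq> M *v w"
  proof
    have ne: "M *v w \<noteq> 0"
      using M[of w w] assms by auto
    have "M *v v \<notin> span {M *v w}"
    proof
      assume "M *v v \<in> span {M *v w}"
      then obtain t where "M *v v = t *\<^sub>R (M *v w)"
        by (auto simp: span_singleton)
      then show False
        using M[of v v] M[of v w] assms by simp
    qed
    then show "independent {M *v v, M *v w}"
      using ne by (simp add: independent_insert)
    show "M *v v \<noteq> M *v w"
      using M[of v v] M[of v w] assms by auto
  qed
  moreover from this have "card {M *v v, M *v w} \<le> dim (range (\<lambda>x. M *v x))"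
    by (intro independent_card_le_dim) auto
  ultimately have "2 \<le> rank M"
    by (simp add: rank_dim_range)
  then show ?thesis
    by (simp add: form_rank_def M_def)
qed

lemma orthonormal_pair:
  fixes V :: "'v::euclidean_space set"
  assumes b: "positive_form b" and V: "subspace V" "2 \<le> dim V"
  obtains e f where "e \<in> V" "f \<in> V" "b e e = 1" "b f f = 1" "b e f = 0"
proof -
  note bil = positive_formD(1)[OF b]
  have normalize: "\<exists>e. e \<in> span {v} \<and> b e e = 1" if "v \<noteq> 0" for v
  proof -
    have "b v v > 0"
      using positive_formD(3)[OF b that] .
    then have "b ((1 / sqrt (b v v)) *\<^sub>R v) ((1 / sqrt (b v v)) *\<^sub>R v) = 1"
      by (simp add: bilinear_simps[OF bil] field_simps)
    then show ?thesis
      using span_base[of v "{v}"] span_scale by blast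
  qed
  have "\<not> V \<subseteq> {0}"
    using V(2) unfolding dim_eq_0[symmetric] by linarith
  then obtain v where v: "v \<in> V" "v \<noteq> 0"
    by auto
  then obtain e where e: "e \<in> span {v}" "b e e = 1"
    using normalize by blast
  have eV: "e \<in> V"
    using e(1) v(1) span_minimal[of "{v}" V] V(1) by auto
  have "\<not> V \<subseteq> span {e}"
  proof
    assume "V \<subseteq> span {e}"
    then have "dim V \<le> card {e}"
      by (intro dim_le_card) auto
    then show False
      using V(2) by simp
  qed
  then obtain x where x: "x \<in> V" "x \<notin> span {e}"
    by blast
  define y where "y = x - b e x *\<^sub>R e"
  have "y \<noteq> 0"
    using x(2) span_scale[OF span_base[of e "{e}"], of "b e x"] by (auto simp: y_def)
  then obtain f where f: "f \<in> span {y}" "b f f = 1"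
    using normalize by blast
  obtain t where t: "f = t *\<^sub>R y"
    using f(1) by (auto simp: span_singleton)
  have "f \<in> V"
    unfolding t y_def using V(1) x(1) eV by (simp add: subspace_diff subspace_scale)
  moreover have "b e f = 0"
    using e(2) by (simp add: t y_def bilinear_simps[OF bil])
  ultimately show ?thesis
    using that e(2) eV f(2) by blast
qed

section \<open>Curvature with two principal curvatures of multiplicity at least two\<close>

text \<open>The situation in one tangent space: \<open>b\<close> stands for the metric, \<open>A\<close> for the shape operator and \<open>c\<close>
  for the curvature of the ambient space. The forms \<open>h\<close>, \<open>curv\<close> and \<open>ric\<close> below then are the second
  fundamental form, the curvature tensor according to the Gauss equation and the Ricci tensor.\<close>

locale two_principal_curvatures =
  fixes b :: "(real ^ 'n::finite) form2" and A :: "real ^ 'n \<Rightarrow> real ^ 'n"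
    and l1 l2 c :: real and p :: nat
  assumes b: "positive_form b" and linear_A: "linear A" and self_adjoint: "b (A v) w = b v (A w)"
    and distinct: "l1 \<noteq> l2"
    and dim1: "dim (eigenspace_of A l1) = p" and dim2: "dim (eigenspace_of A l2) = CARD('n) - p"
    and p: "2 \<le> p" "p \<le> CARD('n) - 2"
begin

definition h :: "(real ^ 'n) form2" where
  "h v w = b (A v) w"

definition curv :: "(real ^ 'n) form4" where
  "curv x y z w = c / 2 * KN b b x y z w + 1 / 2 * KN h h x y z w"

definition ric :: "(real ^ 'n) form2" where
  "ric v w = (real CARD('n) - 1) * c * b v w + trace (matrix A) * h v w - h (A v) w"

text \<open>The eigenvalue of the Ricci operator on the eigenspace of \<open>A\<close> for \<open>l\<close>.\<close>

definition rho :: "real \<Rightarrow> real" where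
  "rho l = (real CARD('n) - 1) * c + trace (matrix A) * l - l\<^sup>2"

lemmas bil = positive_formD(1)[OF b]
lemmas b_sym = positive_formD(2)[OF b]
lemmas nondeg = positive_form_nondegenerate[OF b]

lemma bilinear_h: "bilinear h"
  unfolding bilinear_def h_def
  by (intro conjI allI linearI)
    (simp_all add: bilinear_simps[OF bil] linear_add[OF linear_A] linear_cmul[OF linear_A])

lemma bilinear_ric: "bilinear ric"
  unfolding bilinear_def ric_def
  by (intro conjI allI linearI)
    (simp_all add: bilinear_simps[OF bil] bilinear_simps[OF bilinear_h] linear_add[OF linear_A]
      linear_cmul[OF linear_A] algebra_simps)

lemma eigenspaceD: "v \<in> eigenspace_of A l \<Longrightarrow> A v = l *\<^sub>R v"
  by (simp add: eigenspace_of_def)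

lemma subspace_eigenspace: "subspace (eigenspace_of A l)"
  unfolding eigenspace_of_def subspace_def
  by (simp add: linear_0[OF linear_A] linear_add[OF linear_A] linear_cmul[OF linear_A] scaleR_add_right)

lemma h_eigen: "v \<in> eigenspace_of A l \<Longrightarrow> h v w = l * b v w"
  by (simp add: h_def eigenspaceD bilinear_simps[OF bil])

lemma ric_eigen: "v \<in> eigenspace_of A l \<Longrightarrow> ric v w = rho l * b v w"
  by (simp add: ric_def rho_def h_def eigenspaceD bilinear_simps[OF bil] linear_cmul[OF linear_A]
      power2_eq_square algebra_simps)

lemma eigenspaces_orthogonal:
  assumes "v \<in> eigenspace_of A l1" "w \<in> eigenspace_of A l2"
  shows "b v w = 0"
proof -
  have "l1 * b v w = l2 * b v w"
    using self_adjoint[of v w] assms by (simp add: eigenspaceD bilinear_simps[OF bil])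
  then show ?thesis
    using distinct by simp
qed

lemma eigenspaces_Int: "eigenspace_of A l1 \<inter> eigenspace_of A l2 = {0}"
proof -
  have "v = 0" if "v \<in> eigenspace_of A l1" "v \<in> eigenspace_of A l2" for v
    using eigenspaces_orthogonal[OF that] positive_formD(4)[OF b] by simp
  then show ?thesis
    using subspace_0[OF subspace_eigenspace] by blast
qed

lemma eigen_decomposition:
  obtains e f where "e \<in> eigenspace_of A l1" "f \<in> eigenspace_of A l2" "v = e + f"
proof -
  let ?S = "{x + y |x y. x \<in> eigenspace_of A l1 \<and> y \<in> eigenspace_of A l2}"
  have "dim ?S = CARD('n)"
    using dim_sums_Int[OF subspace_eigenspace[of l1] subspace_eigenspace[of l2]] dim1 dim2 p
    by (simp add: eigenspaces_Int)
  then have "span ?S = UNIV"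
    using dim_eq_full[of ?S] by simp
  then have "v \<in> ?S"
    using span_eq_iff[THEN iffD2, OF subspace_sums[OF subspace_eigenspace subspace_eigenspace]] by blast
  then show ?thesis
    using that by blast
qed

lemma trace_A: "trace (matrix A) = real p * l1 + (real CARD('n) - real p) * l2"
proof -
  obtain B1 where B1: "B1 \<subseteq> eigenspace_of A l1" "independent B1" "eigenspace_of A l1 \<subseteq> span B1"
    "card B1 = p"
    using basis_exists[of "eigenspace_of A l1"] dim1 by auto
  obtain B2 where B2: "B2 \<subseteq> eigenspace_of A l2" "independent B2" "eigenspace_of A l2 \<subseteq> span B2"
    "card B2 = CARD('n) - p"
    using basis_exists[of "eigenspace_of A l2"] dim2 by auto
  have fin: "finite B1" "finite B2"
    using B1(2) B2(2) by (auto intro: finiteI_independent)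
  have disj: "B1 \<inter> B2 = {}"
  proof -
    have "0 \<notin> B1"
      using B1(2) dependent_zero by blast
    moreover have "B1 \<inter> B2 \<subseteq> {0}"
      using B1(1) B2(1) eigenspaces_Int by blast
    ultimately show ?thesis
      by blast
  qed
  have "v \<in> span (B1 \<union> B2)" for v
  proof -
    obtain e f where "e \<in> eigenspace_of A l1" "f \<in> eigenspace_of A l2" "v = e + f"
      by (rule eigen_decomposition)
    moreover have "span B1 \<subseteq> span (B1 \<union> B2)" "span B2 \<subseteq> span (B1 \<union> B2)"
      by (simp_all add: span_mono)
    ultimately show ?thesis
      using B1(3) B2(3) by (auto intro!: span_add)
  qed
  then have span: "span (B1 \<union> B2) = UNIV"
    by auto
  have "card (B1 \<union> B2) = CARD('n)"
    using B1(4) B2(4) p by (simp add: card_Un_disjoint[OF fin disj])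
  then have ind: "independent (B1 \<union> B2)"
    using span fin by (intro card_le_dim_spanning[where V = UNIV]) auto
  define \<mu> where "\<mu> = (\<lambda>v. if v \<in> B1 then l1 else l2)"
  have "trace (matrix A) = sum \<mu> (B1 \<union> B2)"
    using B1(1) B2(1) by (intro trace_eigenbasis linear_A ind span) (auto simp: \<mu>_def dest: eigenspaceD)
  also have "\<dots> = sum \<mu> B1 + sum \<mu> B2"
    by (rule sum.union_disjoint[OF fin disj])
  also have "sum \<mu> B1 = real p * l1"
    by (simp add: \<mu>_def B1(4))
  also have "sum \<mu> B2 = (\<Sum>v\<in>B2. l2)"
    using disj by (intro sum.cong) (auto simp: \<mu>_def)
  also have "\<dots> = (real CARD('n) - real p) * l2"
    using p by (simp add: B2(4) of_nat_diff)
  finally show ?thesis .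
qed

lemma rho_diff: "rho l1 - rho l2 = (l1 - l2) * ((real p - 1) * l1 + (real CARD('n) - real p - 1) * l2)"
  unfolding rho_def trace_A by (simp add: power2_eq_square algebra_simps)

lemma orthonormal_eigenvectors:
  obtains e1 e2 f1 f2 where "e1 \<in> eigenspace_of A l1" "e2 \<in> eigenspace_of A l1"
    "f1 \<in> eigenspace_of A l2" "f2 \<in> eigenspace_of A l2"
    "b e1 e1 = 1" "b e2 e2 = 1" "b e1 e2 = 0" "b f1 f1 = 1" "b f2 f2 = 1" "b f1 f2 = 0"
proof -
  have "2 \<le> dim (eigenspace_of A l1)" "2 \<le> dim (eigenspace_of A l2)"
    using dim1 dim2 p by auto
  note pairs = this[THEN orthonormal_pair[OF b subspace_eigenspace]]
  obtain e1 e2 where "e1 \<in> eigenspace_of A l1" "e2 \<in> eigenspace_of A l1"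
    "b e1 e1 = 1" "b e2 e2 = 1" "b e1 e2 = 0"
    by (rule pairs(1))
  moreover obtain f1 f2 where "f1 \<in> eigenspace_of A l2" "f2 \<in> eigenspace_of A l2"
    "b f1 f1 = 1" "b f2 f2 = 1" "b f1 f2 = 0"
    by (rule pairs(2))
  ultimately show ?thesis
    using that by blast
qed

text \<open>For a Kulkarni-Nomizu product with \<open>b\<close> the sectional curvature of an orthonormal pair is a sum of
  two contributions, one for each vector. Pairing four orthonormal vectors in two ways then gives
  the same sum of sectional curvatures, whereas for the pairings \<open>(e1, e2), (f1, f2)\<close> and
  \<open>(e1, f1), (e2, f2)\<close> of eigenvectors the sums differ by \<open>(l1 - l2)\<^sup>2\<close>.\<close>

lemma curv_not_KN: "\<not> (\<forall>x y z w. curv x y z w = KN b F x y z w)"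
proof
  assume "\<forall>x y z w. curv x y z w = KN b F x y z w"
  then have KN: "curv x y y x = KN b F x y y x" for x y
    by blast
  obtain e1 e2 f1 f2 where E: "e1 \<in> eigenspace_of A l1" "e2 \<in> eigenspace_of A l1"
    "f1 \<in> eigenspace_of A l2" "f2 \<in> eigenspace_of A l2"
    and n: "b e1 e1 = 1" "b e2 e2 = 1" "b e1 e2 = 0" "b f1 f1 = 1" "b f2 f2 = 1" "b f1 f2 = 0"
    by (rule orthonormal_eigenvectors)
  have sect: "c + l * l' = F x x + F y y"
    if "x \<in> eigenspace_of A l" "y \<in> eigenspace_of A l'" "b x x = 1" "b y y = 1" "b x y = 0" for x y l l'
    using KN[of x y] that b_sym[of y x] by (simp add: curv_def KN_def h_eigen ac_simps)
  have "c + l1 * l1 = F e1 e1 + F e2 e2" "c + l2 * l2 = F f1 f1 + F f2 f2"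
    "c + l1 * l2 = F e1 e1 + F f1 f1" "c + l1 * l2 = F e2 e2 + F f2 f2"
    using sect E n eigenspaces_orthogonal by blast+
  then have "(l1 - l2)\<^sup>2 = 0"
    unfolding power2_eq_square by (simp add: algebra_simps)
  then show False
    using distinct by simp
qed

text \<open>Nondegeneracy determines the operator \<open>R\<close> explicitly; as a map of its first argument it is a
  combination of the identity, of \<open>A\<close> and of two rank one maps.\<close>

lemma contraction_curv:
  assumes "\<And>x y z w. b (R x y z) w = curv x y z w"
  shows "trace (matrix (\<lambda>z. R z v w)) = ric v w"
proof -
  have R: "R z v w = (c * b v w) *\<^sub>R z - (c * b z w) *\<^sub>R v + h v w *\<^sub>R A z - h z w *\<^sub>R A v" for z
  proof (rule nondegenerate_eqI[OF nondeg])
    fix y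
    show "b (R z v w) y = b ((c * b v w) *\<^sub>R z - (c * b z w) *\<^sub>R v + h v w *\<^sub>R A z - h z w *\<^sub>R A v) y"
      unfolding assms by (simp add: curv_def KN_def bilinear_simps[OF bil] h_def algebra_simps)
  qed
  have lin: "linear (\<lambda>z. c * b z w)" "linear (\<lambda>z. h z w)"
    using bilinear_h by (auto simp: bilinear_def bilinear_simps[OF bil] algebra_simps intro!: linearI)
  have "trace (matrix (\<lambda>z. R z v w)) = c * b v w * real CARD('n)
      - trace (matrix (\<lambda>z. (c * b z w) *\<^sub>R v)) + h v w * trace (matrix A) - trace (matrix (\<lambda>z. h z w *\<^sub>R A v))"
    unfolding trace_matrix R by (simp add: sum.distrib sum_subtractf sum_distrib_left)
  then show ?thesis
    unfolding trace_rank_one[OF lin(1)] trace_rank_one[OF lin(2)] ric_def by (simp add: algebra_simps)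
qed

text \<open>The two eigenvalues of \<open>ric - \<alpha> b\<close> are distinct, so one of them is nonzero, and its eigenspace
  contains two orthonormal vectors.\<close>

lemma form_rank_ric: "form_rank (\<lambda>v w. ric v w - \<alpha> * b v w) \<noteq> 1" if "rho l1 \<noteq> rho l2"
proof -
  let ?B = "\<lambda>v w. ric v w - \<alpha> * b v w"
  have B: "bilinear ?B"
    unfolding bilinear_def
    by (intro conjI allI linearI)
      (simp_all add: bilinear_simps[OF bil] bilinear_simps[OF bilinear_ric] algebra_simps)
  obtain e1 e2 f1 f2 where E: "e1 \<in> eigenspace_of A l1" "e2 \<in> eigenspace_of A l1"
    "f1 \<in> eigenspace_of A l2" "f2 \<in> eigenspace_of A l2"
    and n: "b e1 e1 = 1" "b e2 e2 = 1" "b e1 e2 = 0" "b f1 f1 = 1" "b f2 f2 = 1" "b f1 f2 = 0"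
    by (rule orthonormal_eigenvectors)
  have "2 \<le> form_rank ?B"
  proof (cases "rho l1 = \<alpha>")
    case True
    then have "rho l2 - \<alpha> \<noteq> 0"
      using that by simp
    then show ?thesis
      using E n b_sym[of f2 f1] by (intro form_rank_ge_2[OF B, of f1 f2]) (simp_all add: ric_eigen)
  next
    case False
    then show ?thesis
      using E n b_sym[of e2 e1] by (intro form_rank_ge_2[OF B, of e1 e2]) (simp_all add: ric_eigen)
  qed
  then show ?thesis
    by simp
qed

lemma ric_not_proportional: "\<not> (\<forall>v w. ric v w = k * b v w)" if "rho l1 \<noteq> rho l2"
proof
  assume prop_eq: "\<forall>v w. ric v w = k * b v w"
  obtain e1 e2 f1 f2 where E: "e1 \<in> eigenspace_of A l1" "e2 \<in> eigenspace_of A l1"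
    "f1 \<in> eigenspace_of A l2" "f2 \<in> eigenspace_of A l2"
    and n: "b e1 e1 = 1" "b e2 e2 = 1" "b e1 e2 = 0" "b f1 f1 = 1" "b f2 f2 = 1" "b f1 f2 = 0"
    by (rule orthonormal_eigenvectors)
  have "rho l1 = k" "rho l2 = k"
    using prop_eq[rule_format, of e1 e1] prop_eq[rule_format, of f1 f1] E n by (simp_all add: ric_eigen)
  then show False
    using that by simp
qed

text \<open>The Ricci operator is annihilated by \<open>(t - \<rho>\<^sub>1) (t - \<rho>\<^sub>2)\<close>, where \<open>\<rho>\<^sub>i = rho li\<close>.\<close>

lemma ric_square: "ric (form_operator b ric v) w = (rho l1 + rho l2) * ric v w + (- (rho l1 * rho l2)) * b v w"
proof -
  have lin: "linear (form_operator b ric)"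
    by (rule linear_form_operator[OF nondeg bilinear_ric])
  have op: "form_operator b ric v = rho l *\<^sub>R v" if "v \<in> eigenspace_of A l" for v l
    by (rule nondegenerate_eqI[OF nondeg])
      (simp add: form_operator_eq[OF nondeg bilinear_ric] ric_eigen[OF that] bilinear_simps[OF bil])
  obtain e f where "e \<in> eigenspace_of A l1" "f \<in> eigenspace_of A l2" "v = e + f"
    by (rule eigen_decomposition)
  then show ?thesis
    by (simp add: linear_add[OF lin] op bilinear_simps[OF bil] bilinear_simps[OF bilinear_ric]
        ric_eigen algebra_simps)
qed

text \<open>On the eigenspaces \<open>h\<close> and \<open>ric\<close> are multiples of \<open>b\<close>; as the multiples of \<open>ric\<close> are distinct,
  interpolation expresses \<open>h\<close> by \<open>ric\<close> and \<open>b\<close>.\<close>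

lemma curv_roter:
  assumes "rho l1 \<noteq> rho l2"
  defines "a \<equiv> (l1 - l2) / (rho l1 - rho l2)"
  defines "d \<equiv> l1 - a * rho l1"
  shows "curv x y z w = a\<^sup>2 / 2 * KN ric ric x y z w + a * d * KN b ric x y z w + (d\<^sup>2 + c) / 2 * KN b b x y z w"
proof -
  have l1: "l1 = a * rho l1 + d"
    by (simp add: d_def)
  have "a * (rho l1 - rho l2) = l1 - l2"
    using assms(1) by (simp add: a_def)
  then have l2: "l2 = a * rho l2 + d"
    by (simp add: d_def algebra_simps)
  have h: "h v w = a * ric v w + d * b v w" for v w
  proof -
    obtain e f where ef: "e \<in> eigenspace_of A l1" "f \<in> eigenspace_of A l2" "v = e + f"
      by (rule eigen_decomposition)
    have "h e w = a * ric e w + d * b e w" "h f w = a * ric f w + d * b f w"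
      unfolding h_eigen[OF ef(1)] h_eigen[OF ef(2)] ric_eigen[OF ef(1)] ric_eigen[OF ef(2)]
      using arg_cong[OF l1, of "\<lambda>t. t * b e w"] arg_cong[OF l2, of "\<lambda>t. t * b f w"]
      by (simp_all add: algebra_simps)
    then show ?thesis
      by (simp add: ef(3) bilinear_simps[OF bil] bilinear_simps[OF bilinear_ric]
          bilinear_simps[OF bilinear_h] algebra_simps)
  qed
  show ?thesis
    unfolding curv_def KN_def h by (simp add: power2_eq_square field_simps)
qed

end

section \<open>Charts and local representatives\<close>

lemma chart_at_in:
  assumes "smooth_manifold M \<A>" "x \<in> topspace M"
  shows "chart_at \<A> x \<in> \<A>" "x \<in> dom_of (chart_at \<A> x)" "coord_at \<A> x \<in> codom_of (chart_at \<A> x)"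
proof -
  have "x \<in> (\<Union>c\<in>\<A>. dom_of c)"
    using assms by (simp add: smooth_manifold_def)
  then have "\<exists>c. c \<in> \<A> \<and> x \<in> dom_of c"
    by blast
  then show "chart_at \<A> x \<in> \<A>" "x \<in> dom_of (chart_at \<A> x)"
    unfolding chart_at_def by (metis (mono_tags, lifting) someI_ex)+
  then show "coord_at \<A> x \<in> codom_of (chart_at \<A> x)"
    by (simp add: coord_at_def)
qed

lemma riemannian_chart_metric:
  assumes "riemannian_manifold M \<A> g" "c \<in> \<A>"
  shows "smooth_metric_on (codom_of c) (g c)" "u \<in> codom_of c \<Longrightarrow> positive_form (g c u)"
proof -
  note riem = assms(1)[unfolded riemannian_manifold_def semi_riemannian_manifold_def]
  note forms = riem[THEN conjunct1, THEN conjunct2, THEN conjunct1]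
    and smooth = riem[THEN conjunct1, THEN conjunct2, THEN conjunct2, THEN conjunct1]
    and pos = riem[THEN conjunct2]
  have "smooth_manifold M \<A>"
    by (rule riem[THEN conjunct1, THEN conjunct1])
  then have "open (codom_of c)"
    using assms(2) by (simp add: smooth_manifold_def is_chart_def)
  then show "smooth_metric_on (codom_of c) (g c)"
    using bspec[OF forms assms(2)] bspec[OF smooth assms(2)]
    unfolding smooth_metric_on_def nondegenerate_symmetric_def by (intro conjI)
  show "positive_form (g c u)" if "u \<in> codom_of c"
    using bspec[OF bspec[OF forms assms(2)] that] bspec[OF bspec[OF pos assms(2)] that]
    unfolding positive_form_def by blast
qed

lemma param_coord:
  assumes "is_chart M c" "x \<in> dom_of c"
  shows "param c (coord c x) = x"
proof -
  have "dom_of c \<subseteq> topspace M"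
    using assms(1) openin_subset by (auto simp: is_chart_def)
  moreover have "inj_on (coord c) (topspace (subtopology M (dom_of c)))"
    using assms(1) homeomorphic_imp_injective_map unfolding is_chart_def by blast
  ultimately have "inj_on (coord c) (dom_of c)"
    by (simp add: Int_absorb1)
  then show ?thesis
    using assms(2) by (simp add: param_def)
qed

lemma local_rep_coord:
  "is_chart M c \<Longrightarrow> x \<in> dom_of c \<Longrightarrow> local_rep c d f (coord c x) = coord d (f x)"
  by (simp add: local_rep_def param_coord)

lemma open_local_rep_domain:
  assumes c: "is_chart M c" and d: "is_chart N d" and f: "continuous_map M N f"
  shows "open (coord c ` (dom_of c \<inter> f -` dom_of d))"
proof -
  have sub: "dom_of c \<subseteq> topspace M"
    using c openin_subset by (auto simp: is_chart_def)
  have "openin M {x \<in> topspace M. f x \<in> dom_of d}"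
    using f d openin_continuous_map_preimage by (auto simp: is_chart_def)
  then have "openin M (dom_of c \<inter> {x \<in> topspace M. f x \<in> dom_of d})"
    using c by (intro openin_Int) (auto simp: is_chart_def)
  moreover have "dom_of c \<inter> {x \<in> topspace M. f x \<in> dom_of d} = dom_of c \<inter> f -` dom_of d"
    using sub by auto
  ultimately have "openin (subtopology M (dom_of c)) (dom_of c \<inter> f -` dom_of d)"
    using c by (simp add: is_chart_def openin_open_subtopology)
  moreover have "open_map (subtopology M (dom_of c)) (top_of_set (codom_of c)) (coord c)"
    using c homeomorphic_imp_open_map by (auto simp: is_chart_def)
  ultimately have "openin (top_of_set (codom_of c)) (coord c ` (dom_of c \<inter> f -` dom_of d))"
    by (simp add: open_map_def)
  moreover have "open (codom_of c)"
    using c by (simp add: is_chart_def)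
  ultimately show ?thesis
    using openin_open_eq by blast
qed

lemma smooth_metric_on_subset:
  assumes "smooth_metric_on S \<gamma>" "open T" "T \<subseteq> S"
  shows "smooth_metric_on T \<gamma>"
  using assms smooth_on_subset[OF smooth_metric_onD(5)[OF assms(1)] assms(3)]
  by (auto simp: smooth_metric_on_def)

section \<open>Hypersurfaces of spaces of constant curvature\<close>

text \<open>The image of \<open>L\<close> and \<open>\<nu>\<close> span the whole space by dimension count, and \<open>a - G a \<nu> \<nu>\<close> is orthogonal to
  both.\<close>

lemma normal_vector_multiple:
  fixes L :: "real ^ 'n::finite \<Rightarrow> real ^ 'm::finite"
  assumes G: "positive_form G" and "linear L" and inj: "\<And>v. L v = 0 \<Longrightarrow> v = 0"
    and card: "CARD('m) = CARD('n) + 1"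
    and \<nu>: "\<And>v. G (L v) \<nu> = 0" "G \<nu> \<nu> = 1" and a: "\<And>v. G a (L v) = 0"
  shows "a = G a \<nu> *\<^sub>R \<nu>"
proof -
  note bil = positive_formD(1)[OF G]
  have "inj L"
    using inj linear_injective_0[OF \<open>linear L\<close>] by blast
  then have "dim (range L) = CARD('n)"
    using dim_image_eq[OF \<open>linear L\<close>, of UNIV] by simp
  moreover have "\<nu> \<notin> range L"
    using \<nu> by force
  then have "\<nu> \<notin> span (range L)"
    unfolding span_eq_iff[THEN iffD2, OF linear_subspace_image[OF \<open>linear L\<close> subspace_UNIV]] .
  ultimately have "dim (insert \<nu> (range L)) = CARD('m)"
    using card by (simp add: dim_insert)
  then have span: "span (insert \<nu> (range L)) = UNIV"
    using dim_eq_full[of "insert \<nu> (range L)"] by simp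
  define d where "d = a - G a \<nu> *\<^sub>R \<nu>"
  have "G d y = 0" if "y \<in> insert \<nu> (range L)" for y
  proof -
    have "G \<nu> (L v) = 0" for v
      using \<nu>(1)[of v] positive_formD(2)[OF G, of \<nu> "L v"] by simp
    then show ?thesis
      using that a \<nu>(2) by (auto simp: d_def bilinear_simps[OF bil])
  qed
  moreover have "linear (G d)"
    using bil by (simp add: bilinear_def)
  ultimately have "G d y = 0" for y
    using linear_eq_0_on_span[of "G d" "insert \<nu> (range L)" y] span by auto
  then have "d = 0"
    using positive_formD(4)[OF G] by blast
  then show ?thesis
    by (simp add: d_def)
qed

text \<open>In codimension one the normal part of the second covariant derivative is \<open>h y z\<close> times the unit
  normal, so that the normal terms of the Gauss equation combine to \<open>1/2 h \<and> h\<close>.\<close>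

lemma hypersurface_curvature:
  fixes \<A> :: "('a, 'n::finite) chart set" and \<B> :: "('b, 'm::finite) chart set"
  assumes M: "riemannian_manifold M \<A> g" and N: "riemannian_manifold N \<B> G"
    and card: "CARD('m) = CARD('n) + 1" and const: "constant_curvature N \<B> G c"
    and f: "isometric_immersion M \<A> g N \<B> G f"
    and x: "x \<in> topspace M" and \<nu>: "unit_normal \<A> \<B> G f x \<nu>"
  defines "h \<equiv> second_fundamental_form \<A> \<B> G f x \<nu>"
  shows "bilinear h" and "h v w = h w v"
    and "riemann \<A> g x x1 x2 x3 x4 =
      c / 2 * KN (metric_at \<A> g x) (metric_at \<A> g x) x1 x2 x3 x4 + 1 / 2 * KN h h x1 x2 x3 x4"
proof -
  have manifolds: "smooth_manifold M \<A>" "smooth_manifold N \<B>"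
    using M N unfolding riemannian_manifold_def semi_riemannian_manifold_def by blast+
  have f_cont: "continuous_map M N f"
    using f by (simp add: isometric_immersion_def)
  then have fx: "f x \<in> topspace N"
    using x by (auto simp: continuous_map_def)
  define k d where "k = chart_at \<A> x" and "d = chart_at \<B> (f x)"
  note k = chart_at_in[OF manifolds(1) x, folded k_def]
    and d = chart_at_in[OF manifolds(2) fx, folded d_def]
  have charts: "is_chart M k" "is_chart N d"
    using manifolds k(1) d(1) by (auto simp: smooth_manifold_def)
  define F where "F = local_rep k d f"
  define U where "U = coord k ` (dom_of k \<inter> f -` dom_of d)"
  define u where "u = coord k x"
  have coord_x: "coord_at \<A> x = u" "coord_at \<B> (f x) = coord d (f x)"
    by (simp_all add: coord_at_def u_def k_def d_def)
  have F_coord: "F (coord k y) = coord d (f y)" if "y \<in> dom_of k" for y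
    unfolding F_def by (rule local_rep_coord[OF charts(1) that])
  have U: "open U" "U \<subseteq> codom_of k"
    using open_local_rep_domain[OF charts f_cont] by (auto simp: U_def)
  have u: "u \<in> U"
    using k(2) d(2) by (auto simp: U_def u_def)
  have FU: "F ` U \<subseteq> codom_of d"
    using F_coord by (auto simp: U_def)
  have Fu: "F u = coord d (f x)" "F u \<in> codom_of d"
    using F_coord[OF k(2)] d(2) by (auto simp: u_def)
  have F: "smooth_on U F"
    using f k(1) d(1) unfolding isometric_immersion_def U_def F_def by blast
  have iso: "g k v a b = G d (F v) (dir_deriv F v a) (dir_deriv F v b)" if v: "v \<in> U" for v a b
  proof -
    obtain y where y: "y \<in> dom_of k" "f y \<in> dom_of d" "v = coord k y"
      using v unfolding U_def by blast
    then have "y \<in> dom_of k \<inter> f -` dom_of d"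
      by simp
    then have "g k (coord k y) a b
        = G d (coord d (f y)) (dir_deriv F (coord k y) a) (dir_deriv F (coord k y) b)"
      using f k(1) d(1) unfolding isometric_immersion_def F_def by blast
    then show ?thesis
      unfolding y(3) F_coord[OF y(1)] .
  qed
  have gk: "smooth_metric_on U (g k)"
    by (rule smooth_metric_on_subset[OF riemannian_chart_metric(1)[OF M k(1)] U])
  note Gd = riemannian_chart_metric(1)[OF N d(1)]
  have pos: "positive_form (g k u)" "positive_form (G d (F u))"
    using riemannian_chart_metric(2)[OF M k(1)] riemannian_chart_metric(2)[OF N d(1) Fu(2)] U u by auto
  have metrics: "metric_at \<A> g x = g k u" "metric_at \<B> G (f x) = G d (F u)"
    by (simp_all add: metric_at_def coord_x Fu(1) k_def d_def)
  have \<nu>1: "G d (F u) \<nu> \<nu> = 1" and \<nu>0: "G d (F u) (dir_deriv F u v) \<nu> = 0" for v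
    using \<nu> unfolding unit_normal_def pushforward_def metrics coord_x k_def[symmetric] d_def[symmetric]
      F_def[symmetric] by simp_all
  define B where "B = (\<lambda>y z. cov_deriv_along (G d) F y (\<lambda>u. dir_deriv F u z) u)"
  have h: "h y z = G d (F u) (B y z) \<nu>" for y z
    unfolding h_def second_fundamental_form_def Let_def metrics coord_x B_def F_def k_def d_def ..
  have Bsym: "B y z = B z y" for y z
    unfolding B_def by (rule second_cov_deriv_symmetric[OF Gd U(1) u F FU])
  show "h v w = h w v" for v w
    unfolding h Bsym[of v w] ..
  have lin: "linear (dir_deriv F u)"
    by (rule linear_frechet_derivative[OF smooth_on_differentiable[OF F u]])
  have lin_h: "linear (\<lambda>y. h y z)" for z
  proof -
    note lin2 = linear_frechet_derivative[OF smooth_on_differentiable[OF smooth_on_dir_deriv[OF F] u]]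
    show ?thesis
      by (rule linearI)
        (simp_all add: h B_def cov_deriv_along_def linear_add[OF lin] linear_cmul[OF lin]
          linear_add[OF lin2] linear_cmul[OF lin2] bilinear_simps[OF bilinear_christoffel[OF Gd Fu(2)]]
          bilinear_simps[OF positive_formD(1)[OF pos(2)]] algebra_simps)
  qed
  have "linear (h y)" for y
  proof -
    have "(\<lambda>z. h z y) = h y"
      using Bsym[of _ y] by (simp add: fun_eq_iff h)
    with lin_h[of y] show ?thesis
      by simp
  qed
  with lin_h show "bilinear h"
    unfolding bilinear_def by blast
  define II where "II = (\<lambda>y z. B y z - dir_deriv F u (christoffel (g k) u y z))"
  have normal: "G d (F u) (II y z) (dir_deriv F u w) = 0" for y z w
    unfolding II_def B_def by (rule gauss_formula_normal[OF gk Gd u F FU iso])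
  have inj: "v = 0" if "dir_deriv F u v = 0" for v
    using iso[OF u, of v v] positive_formD(4)[OF pos(1)] bilinear_lzero[OF positive_formD(1)[OF pos(2)]] that
    by simp
  have "G d (F u) (II y z) \<nu> = h y z" for y z
    by (simp add: II_def h \<nu>0 bilinear_simps[OF positive_formD(1)[OF pos(2)]])
  then have "II y z = h y z *\<^sub>R \<nu>" for y z
    using normal_vector_multiple[OF pos(2) lin inj card \<nu>0 \<nu>1 normal[of y z]] by simp
  then have IIII: "G d (F u) (II a b) (II a' b') = h a b * h a' b'" for a b a' b'
    by (simp add: bilinear_simps[OF positive_formD(1)[OF pos(2)]] \<nu>1)
  have ambient: "curvature_form (G d) (F u) y1 y2 y3 y4 = c / 2 * KN (G d (F u)) (G d (F u)) y1 y2 y3 y4"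
    for y1 y2 y3 y4
  proof (rule constant_sectional_curvature[OF pos(2) curvature_like_curvature_form[OF Gd Fu(2)]])
    fix v w
    have riem: "riemann \<B> G (f x) = curvature_form (G d) (F u)"
      by (simp add: riemann_def coord_x Fu(1) d_def)
    show "curvature_form (G d) (F u) v w w v /
        (G d (F u) v v * G d (F u) w w - (G d (F u) v w)\<^sup>2) = c"
      if "G d (F u) v v * G d (F u) w w - (G d (F u) v w)\<^sup>2 \<noteq> 0"
      using bspec[OF const[unfolded constant_curvature_def] fx, unfolded metrics riem] that by blast
  qed
  have "riemann \<A> g x x1 x2 x3 x4 = curvature_form (g k) u x1 x2 x3 x4"
    by (simp add: riemann_def coord_x k_def)
  also have "\<dots> = curvature_form (G d) (F u) (dir_deriv F u x1) (dir_deriv F u x2) (dir_deriv F u x3)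
      (dir_deriv F u x4) + G d (F u) (II x2 x3) (II x1 x4) - G d (F u) (II x1 x3) (II x2 x4)"
    unfolding II_def B_def by (rule gauss_equation[OF gk Gd u F FU iso])
  also have "\<dots> = c / 2 * KN (g k u) (g k u) x1 x2 x3 x4 + 1 / 2 * KN h h x1 x2 x3 x4"
    unfolding ambient IIII KN_def iso[OF u] by (simp add: algebra_simps)
  finally show "riemann \<A> g x x1 x2 x3 x4 =
      c / 2 * KN (metric_at \<A> g x) (metric_at \<A> g x) x1 x2 x3 x4 + 1 / 2 * KN h h x1 x2 x3 x4"
    unfolding metrics .
qed

section \<open>Kulkarni-Nomizu products with the metric\<close>

text \<open>Conformal flatness and the vanishing of the Weyl tensor both force the curvature tensor to be a
  Kulkarni-Nomizu product with the metric.\<close>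

lemma conformally_flat_riemann_KN:
  fixes \<A> :: "('a, 'n::finite) chart set"
  assumes M: "riemannian_manifold M \<A> g" and "conformally_flat M \<A> g" and x: "x \<in> topspace M"
  shows "\<exists>F. \<forall>x1 x2 x3 x4. riemann \<A> g x x1 x2 x3 x4 = KN (metric_at \<A> g x) F x1 x2 x3 x4"
proof -
  have "smooth_manifold M \<A>"
    using M unfolding riemannian_manifold_def semi_riemannian_manifold_def by blast
  note chart = chart_at_in[OF this x]
  let ?g = "g (chart_at \<A> x)" and ?u = "coord_at \<A> x"
  note bspec[OF assms(2)[unfolded conformally_flat_def] x]
  then obtain V \<sigma> where "open V \<and> ?u \<in> V \<and> V \<subseteq> codom_of (chart_at \<A> x) \<and> smooth_on V \<sigma> \<and>
      (\<forall>u\<in>V. \<forall>x1 x2 x3 x4. curvature_form (\<lambda>u v w. exp (2 * \<sigma> u) * ?g u v w) u x1 x2 x3 x4 = 0)"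
    by (elim exE)
  then have V: "open V" "?u \<in> V" "V \<subseteq> codom_of (chart_at \<A> x)" and \<sigma>: "smooth_on V \<sigma>"
    and flat: "curvature_form (\<lambda>u v w. exp (2 * \<sigma> u) * ?g u v w) ?u x1 x2 x3 x4 = 0" for x1 x2 x3 x4
    by simp_all
  have "smooth_metric_on V ?g"
    by (rule smooth_metric_on_subset[OF riemannian_chart_metric(1)[OF M chart(1)] V(1,3)])
  from curvature_form_conformal[OF this \<sigma> V(2)] obtain F where
    "\<forall>x y z w. curvature_form (\<lambda>u v w. exp (2 * \<sigma> u) * ?g u v w) ?u x y z w
      = exp (2 * \<sigma> ?u) * (curvature_form ?g ?u x y z w - KN (?g ?u) F x y z w)"
    by (elim exE)
  then have "curvature_form ?g ?u x1 x2 x3 x4 = KN (?g ?u) F x1 x2 x3 x4" for x1 x2 x3 x4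
    unfolding flat by simp
  then have "riemann \<A> g x x1 x2 x3 x4 = KN (metric_at \<A> g x) F x1 x2 x3 x4" for x1 x2 x3 x4
    unfolding riemann_def metric_at_def .
  then show ?thesis
    by (intro exI allI)
qed

lemma weyl_zero_riemann_KN:
  fixes \<A> :: "('a, 'n::finite) chart set"
  assumes "weyl \<A> g x = (\<lambda>x1 x2 x3 x4. 0)"
  shows "\<exists>F. \<forall>x1 x2 x3 x4. riemann \<A> g x x1 x2 x3 x4 = KN (metric_at \<A> g x) F x1 x2 x3 x4"
proof -
  define r s where "r = 1 / (real CARD('n) - 2)"
    and "s = scalar_curvature \<A> g x / (2 * (real CARD('n) - 2) * (real CARD('n) - 1))"
  define F where "F = (\<lambda>v w. r * ricci \<A> g x v w - s * metric_at \<A> g x v w)"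
  have "riemann \<A> g x x1 x2 x3 x4 = KN (metric_at \<A> g x) F x1 x2 x3 x4" for x1 x2 x3 x4
  proof -
    have "weyl \<A> g x x1 x2 x3 x4 = 0"
      unfolding assms ..
    then have "riemann \<A> g x x1 x2 x3 x4 = r * KN (metric_at \<A> g x) (ricci \<A> g x) x1 x2 x3 x4
        - s * KN (metric_at \<A> g x) (metric_at \<A> g x) x1 x2 x3 x4"
      unfolding weyl_def r_def[symmetric] s_def[symmetric] by linarith
    then show ?thesis
      by (simp add: F_def KN_def algebra_simps)
  qed
  then show ?thesis
    by (intro exI allI)
qed

section \<open>Hypersurfaces with two principal curvatures\<close>

theorem theorem3p3:
  fixes M :: "'a topology" and \<A> :: "('a, 'n::finite) chart set" and g :: "('a, 'n) metric_tensor"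
    and N :: "'b topology" and \<B> :: "('b, 'm::finite) chart set" and G :: "('b, 'm) metric_tensor"
    and f :: "'a \<Rightarrow> 'b" and \<xi> :: "'a \<Rightarrow> real ^ 'm"
    and c :: real and p :: nat and lam1 lam2 :: "'a \<Rightarrow> real"
  assumes "riemannian_manifold M \<A> g" and "riemannian_manifold N \<B> G"
    and "CARD('m) = CARD('n) + 1" and "4 \<le> CARD('n)"
    and "constant_curvature N \<B> G c"
    and "isometric_immersion M \<A> g N \<B> G f"
    and "2 \<le> p" and "p \<le> CARD('n) - 2"
    and "\<And>x. x \<in> topspace M \<Longrightarrow> unit_normal \<A> \<B> G f x (\<xi> x)"
    and "\<And>x. x \<in> topspace M \<Longrightarrow>
           principal_curvatures \<A> g \<B> G f x (\<xi> x) = {lam1 x, lam2 x} \<and> lam1 x \<noteq> lam2 x \<and>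
           multiplicity_of \<A> g \<B> G f x (\<xi> x) (lam1 x) = p \<and>
           multiplicity_of \<A> g \<B> G f x (\<xi> x) (lam2 x) = CARD('n) - p"
    and "\<And>x. x \<in> topspace M \<Longrightarrow>
           (real p - 1) * lam1 x + (real CARD('n) - real p - 1) * lam2 x \<noteq> 0"
  shows "topspace M = U_S M \<A> g \<inter> U_C M \<A> g \<and>
    (\<exists>\<phi> \<mu> \<eta> :: 'a \<Rightarrow> real. \<forall>x\<in>topspace M. \<forall>x1 x2 x3 x4.
        riemann \<A> g x x1 x2 x3 x4 =
          \<phi> x / 2 * KN (ricci \<A> g x) (ricci \<A> g x) x1 x2 x3 x4
          + \<mu> x * KN (metric_at \<A> g x) (ricci \<A> g x) x1 x2 x3 x4
          + \<eta> x / 2 * KN (metric_at \<A> g x) (metric_at \<A> g x) x1 x2 x3 x4) \<and>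
    roter_space M \<A> g \<and>
    \<not> quasi_einstein M \<A> g \<and> partially_einstein M \<A> g"
proof -
  have semi: "semi_riemannian_manifold M \<A> g"
    using assms(1) unfolding riemannian_manifold_def by (rule conjunct1)
  then have man: "smooth_manifold M \<A>"
    unfolding semi_riemannian_manifold_def by (rule conjunct1)
  have at_point: "\<not> (\<forall>v w. ricci \<A> g x v w = k * metric_at \<A> g x v w)"
      "\<not> (\<forall>x1 x2 x3 x4. riemann \<A> g x x1 x2 x3 x4 = KN (metric_at \<A> g x) F x1 x2 x3 x4)"
      "\<exists>\<phi> \<mu> \<eta>. \<forall>x1 x2 x3 x4. riemann \<A> g x x1 x2 x3 x4 =
          \<phi> / 2 * KN (ricci \<A> g x) (ricci \<A> g x) x1 x2 x3 x4
          + \<mu> * KN (metric_at \<A> g x) (ricci \<A> g x) x1 x2 x3 x4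
          + \<eta> / 2 * KN (metric_at \<A> g x) (metric_at \<A> g x) x1 x2 x3 x4"
      "form_rank (\<lambda>v w. ricci \<A> g x v w - \<alpha> * metric_at \<A> g x v w) \<noteq> 1"
      "\<exists>l m. \<forall>v w. ricci_sq \<A> g x v w = l * ricci \<A> g x v w + m * metric_at \<A> g x v w"
    if x: "x \<in> topspace M" for x k F \<alpha>
  proof -
    define b A where "b = metric_at \<A> g x" and "A = shape_operator \<A> g \<B> G f x (\<xi> x)"
    note hyper = hypersurface_curvature[OF assms(1,2,3,5,6) x assms(9)[OF x]]
    have b: "positive_form b"
      using riemannian_chart_metric(2)[OF assms(1) chart_at_in(1)[OF man x]] chart_at_in(3)[OF man x]
      by (simp add: b_def metric_at_def)
    note nondeg = positive_form_nondegenerate[OF b]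
    have A: "b (A v) w = second_fundamental_form \<A> \<B> G f x (\<xi> x) v w" for v w
      unfolding A_def shape_operator_def b_def[symmetric] by (rule form_operator_eq[OF nondeg hyper(1)])
    interpret P: two_principal_curvatures b A "lam1 x" "lam2 x" c p
    proof (rule two_principal_curvatures.intro)
      show "linear A"
        unfolding A_def shape_operator_def b_def[symmetric] by (rule linear_form_operator[OF nondeg hyper(1)])
      show "b (A v) w = b v (A w)" for v w
        using A[of v w] A[of w v] hyper(2)[of v w] positive_formD(2)[OF b, of v "A w"] by simp
    qed (use b assms(7,8) assms(10)[OF x] in \<open>auto simp: multiplicity_of_def A_def\<close>)
    have sff: "second_fundamental_form \<A> \<B> G f x (\<xi> x) = P.h"
      by (simp add: fun_eq_iff P.h_def A)
    have curv: "riemann \<A> g x x1 x2 x3 x4 = P.curv x1 x2 x3 x4" for x1 x2 x3 x4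
      unfolding hyper(3) sff b_def[symmetric] P.curv_def ..
    have ric: "ricci \<A> g x = P.ric"
    proof (intro ext)
      fix v w
      have "b (curvature_op (g (chart_at \<A> x)) (coord_at \<A> x) y1 y2 y3) y4 = P.curv y1 y2 y3 y4" for y1 y2 y3 y4
        using curv by (simp add: riemann_def curvature_form_def b_def metric_at_def)
      from P.contraction_curv[OF this] show "ricci \<A> g x v w = P.ric v w"
        by (simp add: ricci_def)
    qed
    have rho: "P.rho (lam1 x) \<noteq> P.rho (lam2 x)"
      using P.rho_diff P.distinct assms(11)[OF x] by auto
    show "\<not> (\<forall>v w. ricci \<A> g x v w = k * metric_at \<A> g x v w)"
      using P.ric_not_proportional[OF rho] by (simp add: ric flip: b_def)
    show "\<not> (\<forall>x1 x2 x3 x4. riemann \<A> g x x1 x2 x3 x4 = KN (metric_at \<A> g x) F x1 x2 x3 x4)"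
      using P.curv_not_KN by (simp add: curv flip: b_def)
    show "\<exists>\<phi> \<mu> \<eta>. \<forall>x1 x2 x3 x4. riemann \<A> g x x1 x2 x3 x4 =
          \<phi> / 2 * KN (ricci \<A> g x) (ricci \<A> g x) x1 x2 x3 x4
          + \<mu> * KN (metric_at \<A> g x) (ricci \<A> g x) x1 x2 x3 x4
          + \<eta> / 2 * KN (metric_at \<A> g x) (metric_at \<A> g x) x1 x2 x3 x4"
      unfolding curv ric b_def[symmetric] using P.curv_roter[OF rho] by blast
    show "form_rank (\<lambda>v w. ricci \<A> g x v w - \<alpha> * metric_at \<A> g x v w) \<noteq> 1"
      unfolding ric b_def[symmetric] by (rule P.form_rank_ric[OF rho])
    show "\<exists>l m. \<forall>v w. ricci_sq \<A> g x v w = l * ricci \<A> g x v w + m * metric_at \<A> g x v w"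
      unfolding ricci_sq_def ricci_operator_def ric b_def[symmetric] using P.ric_square by blast
  qed
  have U_S: "U_S M \<A> g = topspace M"
  proof -
    have "x \<in> U_S M \<A> g" if x: "x \<in> topspace M" for x
      using at_point(1)[OF x, of "scalar_curvature \<A> g x / real CARD('n)"] x
      by (auto simp: U_S_def fun_eq_iff)
    then show ?thesis
      by (auto simp: U_S_def)
  qed
  have U_C: "U_C M \<A> g = topspace M"
    using weyl_zero_riemann_KN at_point(2) by (fastforce simp: U_C_def)
  obtain x0 where x0: "x0 \<in> topspace M"
    using man unfolding smooth_manifold_def by blast
  obtain \<phi> \<mu> \<eta> where roter: "\<And>x x1 x2 x3 x4. x \<in> topspace M \<Longrightarrow> riemann \<A> g x x1 x2 x3 x4 =
          \<phi> x / 2 * KN (ricci \<A> g x) (ricci \<A> g x) x1 x2 x3 x4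
          + \<mu> x * KN (metric_at \<A> g x) (ricci \<A> g x) x1 x2 x3 x4
          + \<eta> x / 2 * KN (metric_at \<A> g x) (metric_at \<A> g x) x1 x2 x3 x4"
    using at_point(3) by metis
  have "\<not> conformally_flat M \<A> g"
    using conformally_flat_riemann_KN[OF assms(1) _ x0] at_point(2)[OF x0] by blast
  then have "roter_space M \<A> g"
    unfolding roter_space_def U_S U_C
  proof (intro conjI ballI semi assms(4))
    fix x assume "x \<in> topspace M \<inter> topspace M"
    then have "riemann \<A> g x x1 x2 x3 x4 =
          \<eta> x / 2 * KN (metric_at \<A> g x) (metric_at \<A> g x) x1 x2 x3 x4
          + \<mu> x * KN (metric_at \<A> g x) (ricci \<A> g x) x1 x2 x3 x4
          + \<phi> x / 2 * KN (ricci \<A> g x) (ricci \<A> g x) x1 x2 x3 x4" for x1 x2 x3 x4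
      using roter[of x x1 x2 x3 x4] by simp
    then show "\<exists>a b d. \<forall>x1 x2 x3 x4. riemann \<A> g x x1 x2 x3 x4 =
          a * KN (metric_at \<A> g x) (metric_at \<A> g x) x1 x2 x3 x4
          + b * KN (metric_at \<A> g x) (ricci \<A> g x) x1 x2 x3 x4
          + d * KN (ricci \<A> g x) (ricci \<A> g x) x1 x2 x3 x4"
      by blast
  qed
  moreover have "\<not> quasi_einstein M \<A> g"
    using at_point(4)[OF x0] x0 by (auto simp: quasi_einstein_def U_S)
  moreover have "partially_einstein M \<A> g"
    unfolding partially_einstein_def U_S using at_point(5) by metis
  ultimately show ?thesis
    using U_S U_C roter by blast
qed

end
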